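(* The validity of the dominion condition for a map $f\in\overline{\mathcal{M}}_{nn}$ given by a well-formed expression depends only on the signature of this expression. Moreover, the dominion condition holds for $f$ if and only if all the maps $g\in\overline{\mathcal{M}}_{nn}$ that share a common signature with $f$ have a positive eigenvector (a vector $u\in\mathbb{R}_{>0}^n$ with $g(u)=\lambda u$ for some $\lambda>0$).
   Context: $\mathbb{R}_{>0}^n$ is the set of vectors of $\mathbb{R}^n$ with all entries positive, and $[n]=\{1,\dots,n\}$. Generalized means: for a stochastic vector $\sigma\in\mathbb{R}^m$ ($\sigma_i\ge0$, $\sum_i\sigma_i=1$) with $\operatorname{supp}(\sigma)=\{i\mid\sigma_i>0\}$, and $x\in\mathbb{R}_{>0}^m$, let $M_{r\sigma}(x)=\big(\sum_i\sigma_i x_i^r\big)^{1/r}$ for $r\in\mathbb{R}\setminus\{0\}$ and, by continuity, $M_{0\sigma}(x)=\prod_{i\in\operatorname{supp}(\sigma)}x_i^{\sigma_i}$, $M_{+\infty\,\sigma}(x)=\max_{i\in\operatorname{supp}(\sigma)}x_i$, $M_{-\infty\,\sigma}(x)=\min_{i\in\operatorname{supp}(\sigma)}x_i$. $\overline{\mathcal{M}}_{n1}$ is the set of maps $\mathbb{R}_+^n\to\mathbb{R}$ given by well-formed expressions involving the mean operations $M_{r\sigma}$, the multiplication by a nonnegative scalar, and the variables $x_1,\dots,x_n$. $\overline{\mathcal{M}}_{nn}$ is the set of maps $\mathbb{R}_+^n\to\mathbb{R}_+^n$ whose coordinates belong to $\overline{\mathcal{M}}_{n1}$. Signature of a well-formed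 expression defining a map in $\overline{\mathcal{M}}_{n1}$: the map of $\overline{\mathcal{M}}_{n1}$ obtained by applying the following operations to the expression: delete the multiplicative constants; replace every occurrence of $M_{r\sigma}$ with $r>0$ (resp. $r<0$) by $M_{+\infty\,\sigma}$ (resp. $M_{-\infty\,\sigma}$); replace every occurrence of $M_{0\sigma}$ by the uniform (equal weights) geometric mean of the arguments appearing in the support of $\sigma$. The signature of a vector-valued expression is defined entrywise. Dominion condition for $f$ (regarded as an order-preserving, positively homogeneous of degree one self-map of $\mathbb{R}_{>0}^n$): the two players do not have disjoint dominions in the game $\Gamma_\infty(f)$, i.e., there are no disjoint sets $I,J\subset[n]$ with $I$ a dominion of Min and $J$ a dominion of Max. In this game, the state space is $[n]$; in state $i$, the actions of Min are the sets $I\subset[n]$ with $\lim_{\alpha\to+\infty}f_i(\exp(\alpha e_{I^c}))<+\infty$, and those of Max are the sets $J\subset[n]$ with $\lim_{\alpha\to-\infty}f_i(\exp(\alpha e_{J^c}))>0$, where $K^c=[n]\setminus K$, $e_K\in\mathbb{R}^n$ has entries $1$ on $K$ and $0$ elsewhere, and $\exp$ acts componentwise. The players choose $I$ and $J$ simultaneously and the next state is drawn uniformly in $I\cap J$. A nonempty set $\Delta\subset[n]$ is a dominion of a player if from any initial state in $\Delta$ that player can force the state to stay almost surely in $\Delta$ at each stage, whatever the other player does; equivalently, if for each $i\in\Delta$ the set $\Delta$ is an action of that player in state $i$.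
   Formalization: The multiplicative scalars in well-formed expressions are taken to be positive instead of nonnegative; with zero scalars the claim fails, e.g. 0·x₁ has the same signature as x₁ but no positive eigenvector with λ>0. *)

theory Defs
  imports "HOL-Probability.Probability"
begin

section \<open>Generalized means\<close>

definition stochastic :: "real list \<Rightarrow> bool" where
  "stochastic \<sigma> \<longleftrightarrow> (\<forall>s\<in>set \<sigma>. 0 \<le> s) \<and> sum_list \<sigma> = 1"

definition supp :: "real list \<Rightarrow> nat set" where
  "supp \<sigma> = {i. i < length \<sigma> \<and> 0 < \<sigma> ! i}"

text \<open>The maps below have domain the closed orthant, where a mean of negative order is extended
  by continuity: it vanishes as soon as an argument in the support does (whereas
  \<^term>\<open>0 powr p = (0::real)\<close> in the library). For the other orders the usual formula is already
  the continuous extension.\<close>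

definition gmean :: "ereal \<Rightarrow> real list \<Rightarrow> real list \<Rightarrow> real" where
  "gmean r \<sigma> x = (case r of
      PInfty \<Rightarrow> Max ((!) x ` supp \<sigma>)
    | MInfty \<Rightarrow> Min ((!) x ` supp \<sigma>)
    | ereal p \<Rightarrow>
        if p = 0 then \<Prod>i\<in>supp \<sigma>. (x ! i) powr (\<sigma> ! i)
        else if p < 0 \<and> (\<exists>i\<in>supp \<sigma>. x ! i = 0) then 0
        else (\<Sum>i<length \<sigma>. \<sigma> ! i * (x ! i) powr p) powr (1 / p))"


section \<open>Expressions, the maps they define, and their signatures\<close>

datatype 'n mexpr =
    Var 'n
  | Scale real "'n mexpr"
  | Mean ereal "real list" "'n mexpr list"

text \<open>Scalars have to be positive: with a zero scalar an expression need not define a self-map of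
  the open orthant, and even if it does, deleting the scalar may change the game. For example
  the pairs of maps with coordinates \<open>(0 x\<^sub>1 + x\<^sub>2) / 2, x\<^sub>2\<close> and \<open>(x\<^sub>1 + x\<^sub>2) / 2, x\<^sub>2\<close> would have the
  same signature, but only the first one satisfies the dominion condition.\<close>

fun wf_mexpr :: "'n mexpr \<Rightarrow> bool" where
  "wf_mexpr (Var i) \<longleftrightarrow> True"
| "wf_mexpr (Scale c e) \<longleftrightarrow> 0 < c \<and> wf_mexpr e"
| "wf_mexpr (Mean r \<sigma> es) \<longleftrightarrow>
    stochastic \<sigma> \<and> length es = length \<sigma> \<and> (\<forall>e\<in>set es. wf_mexpr e)"

fun eval_mexpr :: "'n mexpr \<Rightarrow> real ^ 'n \<Rightarrow> real" where
  "eval_mexpr (Var i) x = x $ i"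
| "eval_mexpr (Scale c e) x = c * eval_mexpr e x"
| "eval_mexpr (Mean r \<sigma> es) x = gmean r \<sigma> (map (\<lambda>e. eval_mexpr e x) es)"

definition uniform_weights :: "real list \<Rightarrow> real list" where
  "uniform_weights \<sigma> = map (\<lambda>s. if 0 < s then 1 / real (card (supp \<sigma>)) else 0) \<sigma>"

fun sig_mexpr :: "'n mexpr \<Rightarrow> 'n mexpr" where
  "sig_mexpr (Var i) = Var i"
| "sig_mexpr (Scale c e) = sig_mexpr e"
| "sig_mexpr (Mean r \<sigma> es) =
    (if 0 < r then Mean \<infinity> \<sigma> (map sig_mexpr es)
     else if r < 0 then Mean (-\<infinity>) \<sigma> (map sig_mexpr es)
     else Mean 0 (uniform_weights \<sigma>) (map sig_mexpr es))"

definition nonneg_orthant :: "(real ^ 'n) set" where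
  "nonneg_orthant = {x. \<forall>i. 0 \<le> x $ i}"

definition pos_orthant :: "(real ^ 'n) set" where
  "pos_orthant = {x. \<forall>i. 0 < x $ i}"

text \<open>Maps are made extensional by \<^const>\<open>restrict\<close>, so that their equality is equality on the
  closed orthant. A vector-valued expression is the family of its entries.\<close>

definition mexpr_map :: "'n mexpr \<Rightarrow> real ^ 'n \<Rightarrow> real" where
  "mexpr_map e = restrict (eval_mexpr e) nonneg_orthant"

definition vexpr_map :: "('n \<Rightarrow> 'n mexpr) \<Rightarrow> real ^ 'n \<Rightarrow> real ^ 'n" where
  "vexpr_map E = restrict (\<lambda>x. \<chi> i. eval_mexpr (E i) x) nonneg_orthant"

definition wf_vexpr :: "('n \<Rightarrow> 'n mexpr) \<Rightarrow> bool" where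
  "wf_vexpr E \<longleftrightarrow> (\<forall>i. wf_mexpr (E i))"

definition Mbar :: "(real ^ 'n \<Rightarrow> real ^ 'n) set" where
  "Mbar = {vexpr_map E | E. wf_vexpr E}"

text \<open>A signature is a map, not an expression.\<close>

definition signature :: "'n mexpr \<Rightarrow> real ^ 'n \<Rightarrow> real" where
  "signature e = mexpr_map (sig_mexpr e)"

definition vsignature :: "('n \<Rightarrow> 'n mexpr) \<Rightarrow> 'n \<Rightarrow> real ^ 'n \<Rightarrow> real" where
  "vsignature E = (\<lambda>i. signature (E i))"


section \<open>The game and the dominion condition\<close>

definition min_actions :: "(real ^ 'n \<Rightarrow> real ^ 'n) \<Rightarrow> 'n \<Rightarrow> 'n set set" where
  "min_actions f i =
    {I. \<exists>L::ereal. ((\<lambda>\<alpha>. ereal (f (\<chi> j. exp (\<alpha> * indicator (- I) j)) $ i)) \<longlongrightarrow> L) at_top \<and> L < \<infinity>}"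

definition max_actions :: "(real ^ 'n \<Rightarrow> real ^ 'n) \<Rightarrow> 'n \<Rightarrow> 'n set set" where
  "max_actions f i =
    {J. \<exists>L::real. ((\<lambda>\<alpha>. f (\<chi> j. exp (\<alpha> * indicator (- J) j)) $ i) \<longlongrightarrow> L) at_bot \<and> 0 < L}"

text \<open>Behaviour strategies: a randomized action depending on the current state and on the past
  stages (most recent first), each recorded as the state and the two actions played in it.\<close>

type_synonym 'n history = "('n \<times> 'n set \<times> 'n set) list"

type_synonym 'n strategy = "'n history \<Rightarrow> 'n \<Rightarrow> 'n set pmf"

definition admissible :: "('n \<Rightarrow> 'n set set) \<Rightarrow> 'n strategy \<Rightarrow> bool" where
  "admissible A s \<longleftrightarrow> (\<forall>h i. set_pmf (s h i) \<subseteq> A i)"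

primrec play :: "'n strategy \<Rightarrow> 'n strategy \<Rightarrow> 'n \<Rightarrow> nat \<Rightarrow> ('n history \<times> 'n) pmf" where
  "play s t i 0 = return_pmf ([], i)"
| "play s t i (Suc k) =
    bind_pmf (play s t i k) (\<lambda>(h, j).
      bind_pmf (s h j) (\<lambda>I.
        bind_pmf (t h j) (\<lambda>J.
          map_pmf (\<lambda>j'. ((j, I, J) # h, j')) (pmf_of_set (I \<inter> J)))))"

text \<open>\<open>A\<close> are the actions of the player considered and \<open>B\<close> those of the opponent. The transition
  law is symmetric in the two actions, so the same definition serves for both players.\<close>

definition dominion :: "('n \<Rightarrow> 'n set set) \<Rightarrow> ('n \<Rightarrow> 'n set set) \<Rightarrow> 'n set \<Rightarrow> bool" where
  "dominion A B \<Delta> \<longleftrightarrow> \<Delta> \<noteq> {} \<and>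
    (\<forall>i\<in>\<Delta>. \<exists>s. admissible A s \<and>
      (\<forall>t. admissible B t \<longrightarrow> (\<forall>k. AE x in measure_pmf (play s t i k). snd x \<in> \<Delta>)))"

definition dominion_condition :: "(real ^ 'n \<Rightarrow> real ^ 'n) \<Rightarrow> bool" where
  "dominion_condition f \<longleftrightarrow>
    \<not> (\<exists>I J. I \<inter> J = {} \<and> dominion (min_actions f) (max_actions f) I
                       \<and> dominion (max_actions f) (min_actions f) J)"

definition has_pos_eigenvector :: "(real ^ 'n \<Rightarrow> real ^ 'n) \<Rightarrow> bool" where
  "has_pos_eigenvector g \<longleftrightarrow> (\<exists>u\<in>pos_orthant. \<exists>l>0. g u = l *\<^sub>R u)"

end

theory Submission
  imports Defs "HOL-Real_Asymp.Real_Asymp"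
begin

text \<open>In logarithmic coordinates a map of the class becomes a self-map \<open>T\<close> of \<open>\<real>\<^sup>n\<close> that is
  order preserving and commutes with the addition of constant vectors. Such a map is called
  topical; it does not increase the sup-norm distance. A positive eigenvector of the original map
  is a vector \<open>u\<close> with \<open>T u = u + l\<close> for a constant \<open>l\<close>, and passing to \<open>x \<mapsto> - T (- x)\<close>
  exchanges the two players.

  Since every action set is closed under supersets and contains the whole state space, and since two
  actions of opposite players always meet, a dominion of Min is a nonempty set \<open>I\<close> such that, for
  each \<open>i \<in> I\<close>, the coordinate \<open>T\<^sub>i\<close> stays bounded above when the coordinates outside \<open>I\<close> tend to
  infinity, those in \<open>I\<close> being \<open>0\<close>. A dominion of Max is such a set for \<open>x \<mapsto> - T (- x)\<close>.

  The dominion condition gives an eigenvector. Suppose that vectors \<open>y\<close> with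
  \<open>\<bar>T y - y\<bar> \<le> R\<close> had unbounded oscillation. Along a suitable sequence of them, the states whose
  coordinate stays within a bounded distance of the minimum would form a dominion of Min, and those
  within a bounded distance of the maximum a dominion of Max, and the two sets would be disjoint
  (\<open>slice_bounded\<close>). So the oscillation is bounded. The discounted equation \<open>T ((1 - e) x) = x\<close> has
  a solution by Brouwer's theorem, with \<open>e x\<close> bounded independently of \<open>e\<close>; then
  \<open>y = (1 - e) x\<close> satisfies \<open>T y - y = e x\<close>, hence has bounded oscillation, and so \<open>e x\<close> becomes
  constant as \<open>e\<close> tends to \<open>0\<close>. A limit point of the normalized \<open>y\<close> is an eigenvector
  (\<open>topical_has_eigenvector\<close>).

  Conversely, let \<open>I\<close> and \<open>J\<close> be disjoint dominions of Min and Max. Looking at a state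
  of \<open>I\<close> where an eigenvector is largest among the states of \<open>I\<close>, the eigenvalue is bounded above by a number that depends
  only on the coordinates of the map in \<open>I\<close>; dually, it is bounded below by a number that depends
  only on those in \<open>J\<close>. Multiplying the coordinates in \<open>J\<close> by a large scalar makes the bounds
  incompatible, and leaves the signature unchanged (\<open>rescaling_without_eigenvector\<close>).

  Finally the game depends only on the signature. When the variables in a set \<open>K\<close> tend to \<open>0\<close>
  and the others equal \<open>1\<close>, an expression either tends to \<open>0\<close> or stays bounded away from it.
  A mean of positive order tends to \<open>0\<close> when all its arguments in the support do, a mean of order
  \<open>\<le> 0\<close> when one of them does (\<open>vanishing_dichotomy\<close>), and this rule gives the same answer for an
  expression and for its signature. This describes the actions of Max; those of Min are the actions
  of Max for the reciprocal expression.\<close>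


section \<open>Dominions as closed sets of states\<close>

text \<open>Only the first stage matters for necessity: if the opponent plays the whole state space, the next
  state is uniform in the set \<open>K\<close> chosen by the player, so \<open>K \<subseteq> \<Delta>\<close>, and \<open>\<Delta>\<close> itself is an action.
  Conversely, playing \<open>\<Delta>\<close> at each state of \<open>\<Delta>\<close> confines the state, because \<open>\<Delta>\<close> meets every action
  of the opponent: the uniform law on an empty set would be unspecified.\<close>

lemma dominion_iff:
  fixes A B :: "'n::finite \<Rightarrow> 'n set set"
  assumes up: "\<And>i K L. K \<in> A i \<Longrightarrow> K \<subseteq> L \<Longrightarrow> L \<in> A i"
    and UNIV: "\<And>i. UNIV \<in> A i" "\<And>i. UNIV \<in> B i"
    and meet: "\<And>i K L. K \<in> A i \<Longrightarrow> L \<in> B i \<Longrightarrow> K \<inter> L \<noteq> {}"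
  shows "dominion A B \<Delta> \<longleftrightarrow> \<Delta> \<noteq> {} \<and> (\<forall>i\<in>\<Delta>. \<Delta> \<in> A i)"
proof (intro iffI conjI ballI)
  assume dom: "dominion A B \<Delta>"
  then show "\<Delta> \<noteq> {}"
    by (simp add: dominion_def)
  fix i assume "i \<in> \<Delta>"
  then obtain s where s: "admissible A s"
    and stay: "\<And>t k. admissible B t \<Longrightarrow> AE x in measure_pmf (play s t i k). snd x \<in> \<Delta>"
    using dom unfolding dominion_def by blast
  obtain K where K: "K \<in> set_pmf (s [] i)"
    using set_pmf_not_empty by fast
  then have "K \<in> A i"
    using s by (auto simp: admissible_def)
  then have "K \<noteq> {}"
    using meet[OF _ UNIV(2)] by blast
  have "admissible B (\<lambda>h j. return_pmf UNIV)"
    using UNIV by (simp add: admissible_def)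
  from stay[OF this, of "Suc 0"]
  have "\<forall>x \<in> set_pmf (play s (\<lambda>h j. return_pmf UNIV) i (Suc 0)). snd x \<in> \<Delta>"
    by (simp add: AE_measure_pmf_iff)
  then have "\<forall>K\<in>set_pmf (s [] i). \<forall>j\<in>set_pmf (pmf_of_set K). j \<in> \<Delta>"
    by (simp add: bind_return_pmf)
  then have "K \<subseteq> \<Delta>"
    using K set_pmf_of_set[OF \<open>K \<noteq> {}\<close> finite] by auto
  then show "\<Delta> \<in> A i"
    using \<open>K \<in> A i\<close> up by blast
next
  assume \<Delta>: "\<Delta> \<noteq> {} \<and> (\<forall>i\<in>\<Delta>. \<Delta> \<in> A i)"
  define s :: "'n strategy" where "s = (\<lambda>h j. return_pmf (if j \<in> \<Delta> then \<Delta> else UNIV))"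
  have "admissible A s"
    using \<Delta> UNIV by (simp add: admissible_def s_def)
  moreover have "AE x in measure_pmf (play s t i k). snd x \<in> \<Delta>"
    if "i \<in> \<Delta>" "admissible B t" for t i k
  proof (induction k)
    case (Suc k)
    have "set_pmf (pmf_of_set (\<Delta> \<inter> L)) \<subseteq> \<Delta>" if "j \<in> \<Delta>" "L \<in> set_pmf (t h j)" for h j L
    proof -
      have "\<Delta> \<in> A j" "L \<in> B j"
        using that \<Delta> \<open>admissible B t\<close> by (auto simp: admissible_def)
      then show ?thesis
        using meet by (subst set_pmf_of_set) auto
    qed
    then show ?case
      using Suc by (fastforce simp: AE_measure_pmf_iff s_def bind_return_pmf)
  qed (use that in \<open>simp add: AE_measure_pmf_iff\<close>)
  ultimately show "dominion A B \<Delta>"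
    using \<Delta> unfolding dominion_def by blast
qed


section \<open>Topical maps and their additive eigenvectors\<close>

definition topical :: "(real ^ 'n \<Rightarrow> real ^ 'n) \<Rightarrow> bool" where
  "topical T \<longleftrightarrow> (\<forall>x y. x \<le> y \<longrightarrow> T x \<le> T y) \<and> (\<forall>x c. T (x + vec c) = T x + vec c)"

text \<open>The conjugation that exchanges the two players.\<close>

definition opposite :: "(real ^ 'n \<Rightarrow> real ^ 'n) \<Rightarrow> real ^ 'n \<Rightarrow> real ^ 'n" where
  "opposite T x = - T (- x)"

definition ray :: "'n set \<Rightarrow> real \<Rightarrow> real ^ 'n" where
  "ray K \<alpha> = (\<chi> j. \<alpha> * indicator K j)"

text \<open>The dominions of Min in the game of \<open>T\<close>. Those of Max are obtained by replacing \<open>T\<close> by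
  \<open>opposite T\<close>. For nonpositive \<open>\<alpha>\<close> the bound holds automatically by monotonicity, so quantifying over
  all real \<open>\<alpha>\<close> is the same as letting \<open>\<alpha>\<close> tend to infinity.\<close>

definition closed_class :: "(real ^ 'n \<Rightarrow> real ^ 'n) \<Rightarrow> 'n set \<Rightarrow> bool" where
  "closed_class T I \<longleftrightarrow> I \<noteq> {} \<and> (\<forall>i\<in>I. \<exists>B. \<forall>\<alpha>. T (ray (- I) \<alpha>) $ i \<le> B)"

lemma topical_le_add:
  fixes T :: "real ^ 'n::finite \<Rightarrow> real ^ 'n"
  assumes "topical T" and "\<And>j. x $ j \<le> y $ j + d"
  shows "T x $ i \<le> T y $ i + d"
proof -
  have "x \<le> y + vec d"
    using assms(2) by (simp add: less_eq_vec_def)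
  then have "T x \<le> T y + vec d"
    using assms(1) by (metis topical_def)
  then show ?thesis
    by (simp add: less_eq_vec_def)
qed

lemma topical_opposite:
  fixes T :: "real ^ 'n::finite \<Rightarrow> real ^ 'n"
  assumes "topical T" shows "topical (opposite T)"
proof -
  have "opposite T (x + vec c) = opposite T x + vec c" for x c
  proof -
    have "- (x + vec c) = - x + vec (- c)"
      by (simp add: vec_eq_iff)
    then have "T (- (x + vec c)) = T (- x) + vec (- c)"
      using assms by (metis topical_def)
    then show ?thesis
      by (simp add: opposite_def vec_eq_iff)
  qed
  moreover have "opposite T x \<le> opposite T y" if "x \<le> y" for x y
  proof -
    have "- y \<le> - x"
      using that by (simp add: less_eq_vec_def)
    then have "T (- y) \<le> T (- x)"
      using assms by (simp add: topical_def)
    then show ?thesis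
      by (simp add: opposite_def less_eq_vec_def)
  qed
  ultimately show ?thesis
    by (simp add: topical_def)
qed

lemma continuous_topical:
  fixes T :: "real ^ 'n::finite \<Rightarrow> real ^ 'n"
  assumes "topical T"
  shows "continuous_on S T"
proof -
  have close: "\<bar>T x $ i - T y $ i\<bar> \<le> dist x y" for x y i
  proof -
    have d: "\<bar>x $ j - y $ j\<bar> \<le> dist x y" for j
      using component_le_norm_cart[of "x - y" j] by (simp add: dist_norm)
    have "x $ j \<le> y $ j + dist x y" "y $ j \<le> x $ j + dist x y" for j
      using d[of j] by linarith+
    then have "T x $ i \<le> T y $ i + dist x y" "T y $ i \<le> T x $ i + dist x y"
      using topical_le_add[OF assms] by blast+
    then show ?thesis by linarith
  qed
  have "continuous_on S (\<lambda>x. T x $ i)" for i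
    unfolding continuous_on_iff dist_real_def
    by (meson close dist_commute le_less_trans)
  then have "continuous_on S (\<lambda>x. \<chi> i. T x $ i)"
    by (rule continuous_on_vec_lambda)
  then show ?thesis by simp
qed

text \<open>At a state \<open>i\<close> where \<open>u\<close> is maximal over \<open>I\<close>, the vector \<open>u\<close> lies below \<open>u\<^sub>i\<close> plus a ray in the
  coordinates outside \<open>I\<close>. Hence \<open>l = T\<^sub>i u - u\<^sub>i\<close> is at most the value of \<open>T\<^sub>i\<close> on that ray. The
  equation is required on \<open>I\<close> only, so that the bound survives changes of \<open>T\<close> outside \<open>I\<close>.\<close>

lemma additive_eigenvalue_le:
  fixes T :: "real ^ 'n::finite \<Rightarrow> real ^ 'n"
  assumes T: "topical T" and "I \<noteq> {}"
    and B: "\<And>i \<alpha>. i \<in> I \<Longrightarrow> T (ray (- I) \<alpha>) $ i \<le> B"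
    and eig: "\<And>i. i \<in> I \<Longrightarrow> T u $ i = u $ i + l"
  shows "l \<le> B"
proof -
  obtain i where i: "i \<in> I" "\<And>j. j \<in> I \<Longrightarrow> u $ j \<le> u $ i"
    using arg_min_if_finite[of I "\<lambda>i. - (u $ i)"] \<open>I \<noteq> {}\<close>
    by (metis finite linorder_not_less neg_less_iff_less)
  define \<alpha> where "\<alpha> = Max (range (\<lambda>j. u $ j - u $ i))"
  have "u $ j - u $ i \<le> \<alpha>" for j
    unfolding \<alpha>_def by (rule Max_ge) auto
  then have "u $ j \<le> ray (- I) \<alpha> $ j + u $ i" for j
    using i(2)[of j] by (cases "j \<in> I") (auto simp: ray_def diff_le_eq)
  then have "T u $ i \<le> T (ray (- I) \<alpha>) $ i + u $ i"
    by (rule topical_le_add[OF T])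
  then show ?thesis
    using B[OF i(1), of \<alpha>] eig[OF i(1)] by linarith
qed

text \<open>The number \<open>m k\<close> is the least coordinate of \<open>y k\<close>, and \<open>P\<close> records which coordinates remain at a
  bounded distance from it: \<open>P\<^sub>i > 0\<close> for these, and \<open>P\<^sub>i = 0\<close> for those that drift to infinity
  relatively to the minimum. For a given \<open>\<alpha>\<close>, the vector \<open>y k\<close> eventually lies above
  \<open>m k\<close> plus the ray of height \<open>\<alpha>\<close> in the drifting coordinates, so monotonicity and the upper bound on
  \<open>T\<^sub>i (y k)\<close> control \<open>T\<^sub>i\<close> on this ray, uniformly in \<open>\<alpha>\<close>.\<close>

lemma closed_class_of_low_states:
  fixes T :: "real ^ 'n::finite \<Rightarrow> real ^ 'n"
  assumes T: "topical T"
    and slice: "\<And>k i. T (y k) $ i \<le> y k $ i + R"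
    and m: "\<And>k i. m k \<le> y k $ i" "\<And>k. \<exists>i. y k $ i = m k"
    and lim: "(\<lambda>k. \<chi> i. exp (m k - y k $ i)) \<longlonglongrightarrow> P"
  shows "closed_class T {i. 0 < P $ i}"
proof -
  have lim_i: "(\<lambda>k. exp (m k - y k $ i)) \<longlonglongrightarrow> P $ i" for i
    using tendsto_vec_nth[OF lim, of i] by simp
  \<comment> \<open>The minimum is attained, so one of the summands is \<open>1\<close>; in the limit some \<open>P\<^sub>i\<close> is positive.\<close>
  have "1 \<le> (\<Sum>i\<in>UNIV. exp (m k - y k $ i))" for k
  proof -
    obtain i where "y k $ i = m k"
      using m(2) by blast
    then show ?thesis
      using member_le_sum[of i UNIV "\<lambda>i. exp (m k - y k $ i)"] by simp
  qed
  then have "1 \<le> (\<Sum>i\<in>UNIV. P $ i)"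
    by (intro tendsto_lowerbound[OF tendsto_sum[OF lim_i]]) auto
  then have "{i. 0 < P $ i} \<noteq> {}"
    using sum_nonpos[of UNIV "($) P"] by (force simp: not_less)
  moreover have "\<exists>B. \<forall>\<alpha>. T (ray (- {i. 0 < P $ i}) \<alpha>) $ i \<le> B" if i: "0 < P $ i" for i
  proof (intro exI allI)
    fix \<alpha> :: real
    let ?I = "{i. 0 < P $ i}"
    have "\<forall>\<^sub>F k in sequentially. P $ i / 2 < exp (m k - y k $ i)"
      using order_tendstoD(1)[OF lim_i, of "P $ i / 2"] i by simp
    moreover have "\<forall>\<^sub>F k in sequentially. \<forall>j\<in>-?I. exp (m k - y k $ j) < exp (- \<alpha>)"
    proof (intro eventually_ball_finite ballI)
      fix j assume "j \<in> - ?I"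
      then have "P $ j < exp (- \<alpha>)"
        using exp_gt_zero[of "- \<alpha>"] by (simp add: not_less del: exp_gt_zero)
      then show "\<forall>\<^sub>F k in sequentially. exp (m k - y k $ j) < exp (- \<alpha>)"
        by (rule order_tendstoD(2)[OF lim_i])
    qed simp
    ultimately have "\<forall>\<^sub>F k in sequentially. P $ i / 2 < exp (m k - y k $ i) \<and>
        (\<forall>j\<in>-?I. exp (m k - y k $ j) < exp (- \<alpha>))"
      by (rule eventually_conj)
    then obtain k where k: "P $ i / 2 < exp (m k - y k $ i)"
        "\<And>j. j \<in> - ?I \<Longrightarrow> exp (m k - y k $ j) < exp (- \<alpha>)"
      by (metis (mono_tags, lifting) eventually_sequentially order_refl)
    have "ray (- ?I) \<alpha> $ j \<le> y k $ j + (- m k)" for j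
    proof (cases "j \<in> ?I")
      case False
      then have "m k - y k $ j < - \<alpha>"
        using k(2)[of j] by simp
      then show ?thesis using False by (simp add: ray_def)
    qed (use m(1)[of k j] in \<open>simp add: ray_def\<close>)
    then have "T (ray (- ?I) \<alpha>) $ i \<le> T (y k) $ i + (- m k)"
      by (rule topical_le_add[OF T])
    moreover have "ln (P $ i / 2) < m k - y k $ i"
      using k(1) i by (metis half_gt_zero ln_exp ln_less_cancel_iff exp_gt_zero)
    ultimately show "T (ray (- ?I) \<alpha>) $ i \<le> R - ln (P $ i / 2)"
      using slice[of k i] by linarith
  qed
  ultimately show ?thesis
    by (simp add: closed_class_def)
qed

lemma joint_convergent_subsequence:
  fixes x y :: "nat \<Rightarrow> 'a::euclidean_space"
  assumes "\<And>k. x k \<in> cbox a b" and "\<And>k. y k \<in> cbox c d"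
  shows "\<exists>X Y r. strict_mono (r :: nat \<Rightarrow> nat) \<and> (\<lambda>k. x (r k)) \<longlonglongrightarrow> X \<and> (\<lambda>k. y (r k)) \<longlonglongrightarrow> Y"
proof -
  have "seq_compact (cbox a b \<times> cbox c d)"
    by (intro compact_imp_seq_compact compact_Times compact_cbox)
  moreover have "\<forall>k. (x k, y k) \<in> cbox a b \<times> cbox c d"
    using assms by simp
  ultimately obtain L r where r: "strict_mono (r :: nat \<Rightarrow> nat)"
      and L: "((\<lambda>k. (x k, y k)) \<circ> r) \<longlonglongrightarrow> L"
    by (rule seq_compactE)
  have "(\<lambda>k. x (r k)) \<longlonglongrightarrow> fst L" "(\<lambda>k. y (r k)) \<longlonglongrightarrow> snd L"
    using tendsto_fst[OF L] tendsto_snd[OF L] by (simp_all add: o_def)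
  with r show ?thesis by blast
qed

text \<open>In a sequence of increasing oscillation, the low states form a closed class for \<open>T\<close> and the high
  states, which are the low states of \<open>- y\<close>, form one for \<open>opposite T\<close>.\<close>

lemma slice_bounded:
  fixes T :: "real ^ 'n::finite \<Rightarrow> real ^ 'n"
  assumes T: "topical T"
    and no: "\<And>I J. closed_class T I \<Longrightarrow> closed_class (opposite T) J \<Longrightarrow> I \<inter> J \<noteq> {}"
  shows "\<exists>D. \<forall>y. (\<forall>i. \<bar>T y $ i - y $ i\<bar> \<le> R) \<longrightarrow> (\<forall>i j. y $ i - y $ j \<le> D)"
proof (rule ccontr)
  assume "\<not> ?thesis"
  then have "\<forall>k::nat. \<exists>y. (\<forall>i. \<bar>T y $ i - y $ i\<bar> \<le> R) \<and> (\<exists>i j. real k < y $ i - y $ j)"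
    by (meson not_le)
  then obtain y where slice: "\<And>k i. \<bar>T (y k) $ i - y k $ i\<bar> \<le> R"
      and wide: "\<And>k. \<exists>i j. real k < y k $ i - y k $ j"
    by metis
  define m where "m k = Min (range (($) (y k)))" for k
  define M where "M k = Max (range (($) (y k)))" for k
  have m: "m k \<le> y k $ i" "\<exists>i. y k $ i = m k" for k i
    unfolding m_def using Min_in[of "range (($) (y k))"] by (auto intro: Min_le simp del: Min_in)
  have M: "y k $ i \<le> M k" "\<exists>i. y k $ i = M k" for k i
    unfolding M_def using Max_in[of "range (($) (y k))"] by (auto intro: Max_ge simp del: Max_in)
  define p where "p k = (\<chi> i. exp (m k - y k $ i))" for k
  define q where "q k = (\<chi> i. exp (- M k - (- y k) $ i))" for k
  have "p k \<in> cbox 0 (vec 1)" "q k \<in> cbox 0 (vec 1)" for k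
    using m(1) M(1) by (auto simp: p_def q_def mem_box_cart)
  then obtain P Q r where r: "strict_mono (r :: nat \<Rightarrow> nat)"
      and P: "(\<lambda>k. p (r k)) \<longlonglongrightarrow> P" and Q: "(\<lambda>k. q (r k)) \<longlonglongrightarrow> Q"
    using joint_convergent_subsequence[of p 0 "vec 1" q 0 "vec 1"] by blast
  have "closed_class T {i. 0 < P $ i}"
  proof (rule closed_class_of_low_states[OF T])
    show "T (y (r k)) $ i \<le> y (r k) $ i + R" for k i
      using slice[of "r k" i] by linarith
  qed (use m P in \<open>auto simp: p_def\<close>)
  moreover have "closed_class (opposite T) {i. 0 < Q $ i}"
  proof (rule closed_class_of_low_states[OF topical_opposite[OF T]])
    show "opposite T (- y (r k)) $ i \<le> (- y (r k)) $ i + R" for k i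
      using slice[of "r k" i] by (simp add: opposite_def) 
    show "- M (r k) \<le> (- y (r k)) $ i" "\<exists>i. (- y (r k)) $ i = - M (r k)" for k i
      using M by auto
    show "(\<lambda>k. \<chi> i. exp (- M (r k) - (- y (r k)) $ i)) \<longlonglongrightarrow> Q"
      using Q by (simp add: q_def)
  qed
  \<comment> \<open>No state is both low and high, because the distance between the two extremes tends to infinity.\<close>
  moreover have "P $ i * Q $ i \<le> 0" for i
  proof -
    have "(\<lambda>k. p (r k) $ i * q (r k) $ i) \<longlonglongrightarrow> P $ i * Q $ i"
      by (intro tendsto_mult tendsto_vec_nth P Q)
    moreover have "(\<lambda>k. exp (- real k)) \<longlonglongrightarrow> 0"
      by real_asymp
    moreover have "p (r k) $ i * q (r k) $ i \<le> exp (- real k)" for k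
    proof -
      obtain a b where "real (r k) < y (r k) $ a - y (r k) $ b"
        using wide by blast
      then have "m (r k) - M (r k) \<le> - real k"
        using m(1)[of "r k" b] M(1)[of "r k" a] seq_suble[OF r, of k] by linarith
      then show ?thesis
        by (simp add: p_def q_def flip: exp_add)
    qed
    ultimately show ?thesis
      by (meson LIMSEQ_le)
  qed
  ultimately show False
    using no by (metis (no_types, lifting) disjoint_iff mem_Collect_eq mult_pos_pos not_less)
qed

text \<open>As \<open>T\<close> does not increase the sup-norm distance, \<open>x \<mapsto> T ((1 - e) x)\<close> sends the box of radius \<open>R / e\<close> to
  vectors of norm at most \<open>R + (1 - e) R / e = R / e\<close>, so Brouwer's theorem applies in this box.\<close>

lemma discounted_fixed_point:
  fixes T :: "real ^ 'n::finite \<Rightarrow> real ^ 'n"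
  assumes T: "topical T" and R: "\<And>i. \<bar>T 0 $ i\<bar> \<le> R" and e: "0 < e" "e \<le> 1"
  shows "\<exists>x. T ((1 - e) *\<^sub>R x) = x \<and> (\<forall>i. \<bar>e * x $ i\<bar> \<le> R)"
proof -
  let ?S = "cbox (vec (- (R / e))) (vec (R / e)) :: (real ^ 'n) set"
  have mem: "x \<in> ?S \<longleftrightarrow> (\<forall>i. \<bar>x $ i\<bar> \<le> R / e)" for x
    by (auto simp: mem_box_cart abs_le_iff minus_le_iff)
  have "0 \<le> R"
    using R[of undefined] by linarith
  have "T ((1 - e) *\<^sub>R x) \<in> ?S" if "x \<in> ?S" for x
  proof -
    have x: "\<bar>((1 - e) *\<^sub>R x) $ j\<bar> \<le> (1 - e) * (R / e)" for j
    proof -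
      have "(1 - e) * \<bar>x $ j\<bar> \<le> (1 - e) * (R / e)"
        using that e by (intro mult_left_mono) (auto simp: mem)
      then show ?thesis
        using e by (simp add: abs_mult)
    qed
    have "T ((1 - e) *\<^sub>R x) $ i \<le> T 0 $ i + (1 - e) * (R / e)" for i
      by (rule topical_le_add[OF T]) (use x in \<open>simp add: abs_le_iff\<close>)
    moreover have "T 0 $ i \<le> T ((1 - e) *\<^sub>R x) $ i + (1 - e) * (R / e)" for i
    proof (rule topical_le_add[OF T])
      show "0 $ j \<le> ((1 - e) *\<^sub>R x) $ j + (1 - e) * (R / e)" for j
        using x[of j] unfolding zero_index by linarith
    qed
    moreover have "R + (1 - e) * (R / e) = R / e"
      using e by (simp add: field_simps)
    ultimately have "\<bar>T ((1 - e) *\<^sub>R x) $ i\<bar> \<le> R / e" for i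
      using R[of i] by (smt (verit))
    then show ?thesis by (simp add: mem)
  qed
  moreover have "continuous_on ?S (\<lambda>x. T ((1 - e) *\<^sub>R x))"
    by (rule continuous_on_compose2[OF continuous_topical[OF T, of UNIV]]) (auto intro!: continuous_intros)
  moreover have "0 \<in> ?S"
    using \<open>0 \<le> R\<close> e by (simp add: mem)
  ultimately obtain x where "x \<in> ?S" "T ((1 - e) *\<^sub>R x) = x"
    using brouwer[of ?S "\<lambda>x. T ((1 - e) *\<^sub>R x)"] compact_cbox convex_box(1) by blast
  then show ?thesis
    using e by (auto simp: mem abs_mult field_simps)
qed

text \<open>For the discounted fixed points \<open>x k\<close> and \<open>y k = (1 - e k) x k\<close>, the difference
  \<open>T (y k) - y k = e k x k\<close> is bounded, hence \<open>y k\<close> has bounded oscillation. Subtracting its coordinate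
  at a fixed state \<open>a\<close> therefore produces a bounded sequence \<open>z k\<close> with \<open>T (z k) = z k + w k\<close>, where
  \<open>w k = e k x k\<close> is bounded with oscillation \<open>O(e k)\<close>. Any joint limit point solves the
  eigenvalue equation.\<close>

theorem topical_has_eigenvector:
  fixes T :: "real ^ 'n::finite \<Rightarrow> real ^ 'n"
  assumes T: "topical T"
    and no: "\<And>I J. closed_class T I \<Longrightarrow> closed_class (opposite T) J \<Longrightarrow> I \<inter> J \<noteq> {}"
  shows "\<exists>u l. T u = u + vec l"
proof -
  define R where "R = Max (range (\<lambda>i. \<bar>T 0 $ i\<bar>))"
  have R: "\<bar>T 0 $ i\<bar> \<le> R" for i
    unfolding R_def by (rule Max_ge) auto
  define e :: "nat \<Rightarrow> real" where "e k = 1 / real (k + 2)" for k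
  have e: "0 < e k" "e k \<le> 1 / 2" for k
    by (auto simp: e_def field_simps)
  have "\<exists>x. T ((1 - e k) *\<^sub>R x) = x \<and> (\<forall>i. \<bar>e k * x $ i\<bar> \<le> R)" for k
    by (rule discounted_fixed_point[OF T R e(1) order_trans[OF e(2)]]) simp
  then obtain x where x: "\<And>k. T ((1 - e k) *\<^sub>R x k) = x k" "\<And>k i. \<bar>e k * x k $ i\<bar> \<le> R"
    by metis
  obtain D where D: "\<And>y i j. (\<And>i. \<bar>T y $ i - y $ i\<bar> \<le> R) \<Longrightarrow> y $ i - y $ j \<le> D"
    using slice_bounded[OF T no, of R] by blast
  define a :: 'n where "a = undefined"
  define y where "y k = (1 - e k) *\<^sub>R x k" for k
  have Ty: "T (y k) = y k + e k *\<^sub>R x k" for k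
    using x(1) by (simp add: y_def algebra_simps)
  have osc: "\<bar>y k $ i - y k $ j\<bar> \<le> D" for k i j
  proof -
    have "\<bar>T (y k) $ i - y k $ i\<bar> \<le> R" for i
      using x(2) by (simp add: Ty)
    from D[OF this, of i j] D[OF this, of j i] show ?thesis by linarith
  qed
  define z where "z k = y k + vec (- y k $ a)" for k
  define w where "w k = e k *\<^sub>R x k" for k
  have Tz: "T (z k) = z k + w k" for k
    using T by (simp add: z_def w_def topical_def Ty)
  have "z k \<in> cbox (vec (- D)) (vec D)" for k
    using osc[of k _ a] by (simp add: mem_box_cart z_def abs_le_iff) (smt (verit))
  moreover have "w k \<in> cbox (vec (- R)) (vec R)" for k
    using x(2)[of k] by (simp add: mem_box_cart w_def abs_le_iff) (smt (verit))
  ultimately obtain Z W r where r: "strict_mono (r :: nat \<Rightarrow> nat)"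
      and Z: "(\<lambda>k. z (r k)) \<longlonglongrightarrow> Z" and W: "(\<lambda>k. w (r k)) \<longlonglongrightarrow> W"
    using joint_convergent_subsequence[of z _ _ w] by blast
  have "(\<lambda>k. T (z (r k))) \<longlonglongrightarrow> T Z"
    using continuous_on_tendsto_compose[OF continuous_topical[OF T, of UNIV] Z] by simp
  moreover have "(\<lambda>k. T (z (r k))) \<longlonglongrightarrow> Z + W"
    unfolding Tz by (rule tendsto_add[OF Z W])
  ultimately have "T Z = Z + W"
    by (rule LIMSEQ_unique)
  moreover have "W $ i - W $ a = 0" for i
  proof (rule LIMSEQ_unique)
    show "(\<lambda>k. w (r k) $ i - w (r k) $ a) \<longlonglongrightarrow> W $ i - W $ a"
      by (intro tendsto_diff tendsto_vec_nth W)
    have bound: "\<bar>w k $ i - w k $ a\<bar> \<le> e k * (2 * D)" for k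
    proof -
      have "(1 - e k) * \<bar>x k $ i - x k $ a\<bar> \<le> D"
        using osc[of k i a] e[of k] by (simp add: y_def abs_mult flip: right_diff_distrib)
      moreover have "1 / 2 * \<bar>x k $ i - x k $ a\<bar> \<le> (1 - e k) * \<bar>x k $ i - x k $ a\<bar>"
        using e[of k] by (intro mult_right_mono) auto
      ultimately have "1 / 2 * \<bar>x k $ i - x k $ a\<bar> \<le> D" by (rule order_trans[rotated])
      then have "\<bar>x k $ i - x k $ a\<bar> \<le> 2 * D" by simp
      then have "e k * \<bar>x k $ i - x k $ a\<bar> \<le> e k * (2 * D)"
        using e(1)[of k] by simp
      then show ?thesis
        using e(1)[of k] by (simp add: w_def abs_mult flip: right_diff_distrib)
    qed
    have "(\<lambda>k. e k * (2 * D)) \<longlonglongrightarrow> 0"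
      unfolding e_def by real_asymp
    then have "(\<lambda>k. e (r k) * (2 * D)) \<longlonglongrightarrow> 0"
      using LIMSEQ_subseq_LIMSEQ[OF _ r] by (auto simp: o_def)
    then show "(\<lambda>k. w (r k) $ i - w (r k) $ a) \<longlonglongrightarrow> 0"
      by (rule Lim_null_comparison[rotated]) (use bound in auto)
  qed
  then have "W = vec (W $ a)"
    by (simp add: vec_eq_iff)
  ultimately show ?thesis by metis
qed

text \<open>There are only finitely many states, so the bounds at the states of a class can be merged.\<close>

lemma closed_class_uniform_bound:
  fixes T :: "real ^ 'n::finite \<Rightarrow> real ^ 'n"
  assumes "closed_class T I"
  shows "\<exists>B. \<forall>i\<in>I. \<forall>\<alpha>. T (ray (- I) \<alpha>) $ i \<le> B"
proof -
  obtain B where B: "\<And>i \<alpha>. i \<in> I \<Longrightarrow> T (ray (- I) \<alpha>) $ i \<le> B i"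
    using assms unfolding closed_class_def by metis
  have "B i \<le> Max (range B)" for i by (rule Max_ge) auto
  then show ?thesis using B order_trans by blast
qed


section \<open>The game in logarithmic coordinates\<close>

text \<open>By monotonicity the limits that define the actions always exist, as the supremum and the infimum
  of the function, so being an action is a boundedness property.\<close>

lemma mono_limit_below_infinity_iff:
  fixes \<phi> :: "real \<Rightarrow> real"
  assumes "mono \<phi>"
  shows "(\<exists>L::ereal. ((\<lambda>\<alpha>. ereal (\<phi> \<alpha>)) \<longlongrightarrow> L) at_top \<and> L < \<infinity>) \<longleftrightarrow> (\<exists>B. \<forall>\<alpha>. \<phi> \<alpha> \<le> B)"
proof
  assume "\<exists>L::ereal. ((\<lambda>\<alpha>. ereal (\<phi> \<alpha>)) \<longlongrightarrow> L) at_top \<and> L < \<infinity>"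
  then obtain L :: ereal where L: "((\<lambda>\<alpha>. ereal (\<phi> \<alpha>)) \<longlongrightarrow> L) at_top" "L < \<infinity>"
    by blast
  then obtain B where "L < ereal B"
    using ereal_dense2 by blast
  then have "\<forall>\<^sub>F \<alpha> in at_top. \<phi> \<alpha> < B"
    using order_tendstoD(2)[OF L(1)] by fastforce
  then obtain \<alpha>0 where *: "\<And>\<alpha>. \<alpha>0 \<le> \<alpha> \<Longrightarrow> \<phi> \<alpha> < B"
    by (auto simp: eventually_at_top_linorder)
  have "\<phi> \<alpha> \<le> B" for \<alpha>
    using *[of "max \<alpha> \<alpha>0"] monoD[OF assms, of \<alpha> "max \<alpha> \<alpha>0"] by simp
  then show "\<exists>B. \<forall>\<alpha>. \<phi> \<alpha> \<le> B" by blast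
next
  assume "\<exists>B. \<forall>\<alpha>. \<phi> \<alpha> \<le> B"
  then obtain B where B: "\<And>\<alpha>. \<phi> \<alpha> \<le> B" by blast
  let ?L = "SUP \<alpha>. ereal (\<phi> \<alpha>)"
  have "((\<lambda>\<alpha>. ereal (\<phi> \<alpha>)) \<longlongrightarrow> ?L) at_top"
  proof (rule order_tendstoI)
    fix a assume "a < ?L"
    then obtain \<alpha>0 where "a < ereal (\<phi> \<alpha>0)"
      by (auto simp: less_SUP_iff)
    then show "\<forall>\<^sub>F \<alpha> in at_top. a < ereal (\<phi> \<alpha>)"
      by (intro eventually_mono[OF eventually_ge_at_top[of \<alpha>0]])
        (metis assms ereal_less_eq(3) less_le_trans monoD)
  next
    fix a assume "?L < a"
    then show "\<forall>\<^sub>F \<alpha> in at_top. ereal (\<phi> \<alpha>) < a"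
      by (intro always_eventually allI) (metis SUP_upper UNIV_I le_less_trans)
  qed
  moreover have "?L \<le> ereal B"
    using B by (intro SUP_least) simp
  then have "?L < \<infinity>"
    by (metis ereal_infty_less(1) le_less_trans less_ereal.simps(4) not_less)
  ultimately show "\<exists>L::ereal. ((\<lambda>\<alpha>. ereal (\<phi> \<alpha>)) \<longlongrightarrow> L) at_top \<and> L < \<infinity>"
    by blast
qed

lemma mono_limit_above_zero_iff:
  fixes \<phi> :: "real \<Rightarrow> real"
  assumes "mono \<phi>"
  shows "(\<exists>L. (\<phi> \<longlongrightarrow> L) at_bot \<and> 0 < L) \<longleftrightarrow> (\<exists>c>0. \<forall>\<alpha>. c \<le> \<phi> \<alpha>)"
proof
  assume "\<exists>L. (\<phi> \<longlongrightarrow> L) at_bot \<and> 0 < L"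
  then obtain L where L: "(\<phi> \<longlongrightarrow> L) at_bot" "0 < L"
    by blast
  then obtain \<alpha>0 where *: "\<And>\<alpha>. \<alpha> \<le> \<alpha>0 \<Longrightarrow> L / 2 < \<phi> \<alpha>"
    using order_tendstoD(1)[OF L(1), of "L / 2"] by (auto simp: eventually_at_bot_linorder)
  have "L / 2 \<le> \<phi> \<alpha>" for \<alpha>
    using *[of "min \<alpha> \<alpha>0"] monoD[OF assms, of "min \<alpha> \<alpha>0" \<alpha>] by simp
  then show "\<exists>c>0. \<forall>\<alpha>. c \<le> \<phi> \<alpha>"
    using \<open>0 < L\<close> half_gt_zero by blast
next
  assume "\<exists>c>0. \<forall>\<alpha>. c \<le> \<phi> \<alpha>"
  then obtain c where c: "0 < c" "\<And>\<alpha>. c \<le> \<phi> \<alpha>" by blast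
  then have bdd: "bdd_below (range \<phi>)"
    by (auto simp: bdd_below_def)
  let ?L = "INF \<alpha>. \<phi> \<alpha>"
  have "(\<phi> \<longlongrightarrow> ?L) at_bot"
  proof (rule order_tendstoI)
    fix a assume "?L < a"
    then obtain \<alpha>0 where "\<phi> \<alpha>0 < a"
      using bdd by (auto simp: cINF_less_iff)
    then show "\<forall>\<^sub>F \<alpha> in at_bot. \<phi> \<alpha> < a"
      by (intro eventually_mono[OF eventually_le_at_bot[of \<alpha>0]])
        (metis assms le_less_trans monoD)
  next
    fix a assume "a < ?L"
    then show "\<forall>\<^sub>F \<alpha> in at_bot. a < \<phi> \<alpha>"
      by (intro always_eventually allI) (metis bdd cINF_lower UNIV_I less_le_trans)
  qed
  moreover have "c \<le> ?L"
    using c(2) by (intro cINF_greatest) auto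
  ultimately show "\<exists>L. (\<phi> \<longlongrightarrow> L) at_bot \<and> 0 < L"
    using c(1) less_le_trans by blast
qed

definition order_homogeneous :: "(real ^ 'n \<Rightarrow> real ^ 'n) \<Rightarrow> bool" where
  "order_homogeneous f \<longleftrightarrow>
     (\<forall>x\<in>pos_orthant. f x \<in> pos_orthant) \<and>
     (\<forall>x\<in>pos_orthant. \<forall>y\<in>pos_orthant. x \<le> y \<longrightarrow> f x \<le> f y) \<and>
     (\<forall>x\<in>pos_orthant. \<forall>c>0. f (c *\<^sub>R x) = c *\<^sub>R f x)"

definition exp_vec :: "real ^ 'n \<Rightarrow> real ^ 'n" where
  "exp_vec x = (\<chi> j. exp (x $ j))"

definition log_conjugate :: "(real ^ 'n \<Rightarrow> real ^ 'n) \<Rightarrow> real ^ 'n \<Rightarrow> real ^ 'n" where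
  "log_conjugate f x = (\<chi> i. ln (f (exp_vec x) $ i))"

lemma exp_vec_pos: "exp_vec x \<in> pos_orthant"
  by (simp add: exp_vec_def pos_orthant_def)

lemma exp_log_conjugate:
  assumes "order_homogeneous f"
  shows "exp_vec (log_conjugate f x) = f (exp_vec x)"
proof -
  have "f (exp_vec x) \<in> pos_orthant"
    using assms exp_vec_pos by (auto simp: order_homogeneous_def)
  then show ?thesis
    by (simp add: exp_vec_def log_conjugate_def pos_orthant_def vec_eq_iff)
qed

lemma exp_vec_add: "exp_vec (x + vec c) = exp c *\<^sub>R exp_vec x"
  by (simp add: exp_vec_def vec_eq_iff exp_add)

lemma exp_vec_inject: "exp_vec x = exp_vec y \<longleftrightarrow> x = y"
  by (simp add: exp_vec_def vec_eq_iff)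

lemma exp_vec_mono: "exp_vec x \<le> exp_vec y \<longleftrightarrow> x \<le> y"
  by (simp add: exp_vec_def less_eq_vec_def)

lemma topical_log_conjugate:
  fixes f :: "real ^ 'n::finite \<Rightarrow> real ^ 'n"
  assumes f: "order_homogeneous f"
  shows "topical (log_conjugate f)"
  unfolding topical_def
proof (intro conjI allI impI)
  fix x y :: "real ^ 'n" assume "x \<le> y"
  then have "exp_vec x \<le> exp_vec y"
    by (simp add: exp_vec_mono)
  then have "f (exp_vec x) \<le> f (exp_vec y)"
    using f exp_vec_pos unfolding order_homogeneous_def by blast
  then show "log_conjugate f x \<le> log_conjugate f y"
    by (simp add: exp_log_conjugate[OF f, symmetric] exp_vec_mono)
next
  fix x :: "real ^ 'n" and c
  have "f (exp_vec (x + vec c)) = exp c *\<^sub>R f (exp_vec x)"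
    using f exp_vec_pos[of x] exp_gt_zero[of c] unfolding order_homogeneous_def exp_vec_add by blast
  then show "log_conjugate f (x + vec c) = log_conjugate f x + vec c"
    by (simp add: exp_log_conjugate[OF f, symmetric] exp_vec_add[symmetric] exp_vec_inject)
qed

lemma mono_log_conjugate_ray:
  fixes f :: "real ^ 'n::finite \<Rightarrow> real ^ 'n"
  assumes f: "order_homogeneous f"
  shows "mono (\<lambda>\<alpha>. log_conjugate f (ray K \<alpha>) $ i)"
proof (rule monoI)
  fix a b :: real assume "a \<le> b"
  then have "ray K a \<le> ray K b"
    by (simp add: ray_def less_eq_vec_def indicator_def)
  then show "log_conjugate f (ray K a) $ i \<le> log_conjugate f (ray K b) $ i"
    using topical_log_conjugate[OF f] by (simp add: topical_def less_eq_vec_def)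
qed

lemma eval_on_ray:
  assumes "order_homogeneous f"
  shows "f (\<chi> j. exp (\<alpha> * indicator K j)) $ i = exp (log_conjugate f (ray K \<alpha>) $ i)"
proof -
  have "(\<chi> j. exp (\<alpha> * indicator K j)) = exp_vec (ray K \<alpha>)"
    by (simp add: exp_vec_def ray_def)
  then show ?thesis
    by (simp add: exp_log_conjugate[OF assms, symmetric]) (simp add: exp_vec_def)
qed

lemma min_actions_iff:
  fixes f :: "real ^ 'n::finite \<Rightarrow> real ^ 'n"
  assumes f: "order_homogeneous f"
  shows "I \<in> min_actions f i \<longleftrightarrow> (\<exists>B. \<forall>\<alpha>. log_conjugate f (ray (- I) \<alpha>) $ i \<le> B)"
proof -
  let ?\<phi> = "\<lambda>\<alpha>. log_conjugate f (ray (- I) \<alpha>) $ i"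
  have "mono (\<lambda>\<alpha>. exp (?\<phi> \<alpha>))"
    using mono_log_conjugate_ray[OF f] by (simp add: mono_def)
  from mono_limit_below_infinity_iff[OF this]
  have "I \<in> min_actions f i \<longleftrightarrow> (\<exists>B. \<forall>\<alpha>. exp (?\<phi> \<alpha>) \<le> B)"
    by (simp add: min_actions_def eval_on_ray[OF f])
  also have "\<dots> \<longleftrightarrow> (\<exists>B. \<forall>\<alpha>. ?\<phi> \<alpha> \<le> B)"
  proof
    assume "\<exists>B. \<forall>\<alpha>. exp (?\<phi> \<alpha>) \<le> B"
    then obtain B where "\<And>\<alpha>. exp (?\<phi> \<alpha>) \<le> B" by blast
    then have "?\<phi> \<alpha> \<le> ln B" for \<alpha>
      by (metis exp_gt_zero less_le_trans ln_exp ln_le_cancel_iff)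
    then show "\<exists>B. \<forall>\<alpha>. ?\<phi> \<alpha> \<le> B" by blast
  qed (meson exp_le_cancel_iff)
  finally show ?thesis .
qed

lemma max_actions_lower_bound_iff:
  fixes f :: "real ^ 'n::finite \<Rightarrow> real ^ 'n"
  assumes f: "order_homogeneous f"
  shows "J \<in> max_actions f i \<longleftrightarrow> (\<exists>c>0. \<forall>\<alpha>. c \<le> f (exp_vec (ray (- J) \<alpha>)) $ i)"
proof -
  let ?\<phi> = "\<lambda>\<alpha>. log_conjugate f (ray (- J) \<alpha>) $ i"
  have "mono (\<lambda>\<alpha>. exp (?\<phi> \<alpha>))"
    using mono_log_conjugate_ray[OF f] by (simp add: mono_def)
  from mono_limit_above_zero_iff[OF this]
  have "J \<in> max_actions f i \<longleftrightarrow> (\<exists>c>0. \<forall>\<alpha>. c \<le> exp (?\<phi> \<alpha>))"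
    by (simp add: max_actions_def eval_on_ray[OF f])
  also have "\<dots> \<longleftrightarrow> (\<exists>c>0. \<forall>\<alpha>. c \<le> f (exp_vec (ray (- J) \<alpha>)) $ i)"
    by (simp add: exp_log_conjugate[OF f, symmetric]) (simp add: exp_vec_def)
  finally show ?thesis .
qed

lemma max_actions_iff:
  fixes f :: "real ^ 'n::finite \<Rightarrow> real ^ 'n"
  assumes f: "order_homogeneous f"
  shows "J \<in> max_actions f i \<longleftrightarrow> (\<exists>B. \<forall>\<alpha>. opposite (log_conjugate f) (ray (- J) \<alpha>) $ i \<le> B)"
proof -
  let ?\<phi> = "\<lambda>\<alpha>. log_conjugate f (ray (- J) \<alpha>) $ i"
  have "J \<in> max_actions f i \<longleftrightarrow> (\<exists>c>0. \<forall>\<alpha>. c \<le> exp (?\<phi> \<alpha>))"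
    using max_actions_lower_bound_iff[OF f]
    by (simp add: exp_log_conjugate[OF f, symmetric]) (simp add: exp_vec_def)
  also have "\<dots> \<longleftrightarrow> (\<exists>B. \<forall>\<alpha>. - B \<le> ?\<phi> \<alpha>)"
  proof
    assume "\<exists>c>0. \<forall>\<alpha>. c \<le> exp (?\<phi> \<alpha>)"
    then obtain c where "0 < c" "\<And>\<alpha>. c \<le> exp (?\<phi> \<alpha>)" by blast
    then have "- (- ln c) \<le> ?\<phi> \<alpha>" for \<alpha>
      by (metis exp_gt_zero ln_exp ln_le_cancel_iff minus_minus)
    then show "\<exists>B. \<forall>\<alpha>. - B \<le> ?\<phi> \<alpha>" by blast
  qed (meson exp_gt_zero exp_le_cancel_iff)
  also have "\<dots> \<longleftrightarrow> (\<exists>B. \<forall>\<alpha>. - B \<le> ?\<phi> (- \<alpha>))"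
    by (metis minus_minus)
  also have "\<dots> \<longleftrightarrow> (\<exists>B. \<forall>\<alpha>. opposite (log_conjugate f) (ray (- J) \<alpha>) $ i \<le> B)"
  proof -
    have "- ray (- J) \<alpha> = ray (- J) (- \<alpha>)" for \<alpha>
      by (simp add: ray_def vec_eq_iff)
    then show ?thesis
      by (simp add: opposite_def minus_le_iff)
  qed
  finally show ?thesis .
qed

lemma bounded_ray_UNIV: "\<exists>B. \<forall>\<alpha>. T (ray (- UNIV) \<alpha>) $ i \<le> (B::real)"
  by (auto simp: ray_def)

lemma bounded_ray_mono:
  fixes T :: "real ^ 'n::finite \<Rightarrow> real ^ 'n"
  assumes T: "topical T" and B: "\<exists>B. \<forall>\<alpha>. T (ray (- K) \<alpha>) $ i \<le> B" and "K \<subseteq> L"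
  shows "\<exists>B. \<forall>\<alpha>. T (ray (- L) \<alpha>) $ i \<le> B"
proof -
  obtain B where B: "\<And>\<alpha>. T (ray (- K) \<alpha>) $ i \<le> B"
    using B by blast
  have "T (ray (- L) \<alpha>) $ i \<le> B" for \<alpha>
  proof -
    have "ray (- L) \<alpha> $ j \<le> ray (- K) \<bar>\<alpha>\<bar> $ j + 0" for j
      using \<open>K \<subseteq> L\<close> by (auto simp: ray_def indicator_def)
    then have "T (ray (- L) \<alpha>) $ i \<le> T (ray (- K) \<bar>\<alpha>\<bar>) $ i + 0"
      by (rule topical_le_add[OF T])
    then show ?thesis using B[of "\<bar>\<alpha>\<bar>"] by linarith
  qed
  then show ?thesis by blast
qed

text \<open>If \<open>I\<close> and \<open>J\<close> were disjoint, the ray of height \<open>\<alpha>\<close> outside \<open>I\<close> would dominate the ray of height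
  \<open>- \<alpha>\<close> outside \<open>J\<close> shifted by \<open>\<alpha>\<close>. On the former \<open>T\<^sub>i\<close> is bounded above, on the latter
  \<open>T\<^sub>i\<close> is at least \<open>\<alpha>\<close> minus a constant.\<close>

lemma bounded_rays_meet:
  fixes T :: "real ^ 'n::finite \<Rightarrow> real ^ 'n"
  assumes T: "topical T" and B: "\<exists>B. \<forall>\<alpha>. T (ray (- I) \<alpha>) $ i \<le> B"
    and C: "\<exists>C. \<forall>\<alpha>. opposite T (ray (- J) \<alpha>) $ i \<le> C"
  shows "I \<inter> J \<noteq> {}"
proof
  assume "I \<inter> J = {}"
  obtain B C where BC: "\<And>\<alpha>. T (ray (- I) \<alpha>) $ i \<le> B" "\<And>\<alpha>. - T (- ray (- J) \<alpha>) $ i \<le> C"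
    using B C by (auto simp: opposite_def)
  define \<alpha> where "\<alpha> = \<bar>B\<bar> + \<bar>C\<bar> + 1"
  have "(- ray (- J) \<alpha>) $ j \<le> ray (- I) \<alpha> $ j + (- \<alpha>)" for j
    using \<open>I \<inter> J = {}\<close> by (auto simp: ray_def indicator_def \<alpha>_def)
  then have "T (- ray (- J) \<alpha>) $ i \<le> T (ray (- I) \<alpha>) $ i + (- \<alpha>)"
    by (rule topical_le_add[OF T])
  then show False
    using BC[of \<alpha>] unfolding \<alpha>_def by simp linarith
qed

lemma dominion_condition_iff:
  fixes f :: "real ^ 'n::finite \<Rightarrow> real ^ 'n"
  assumes f: "order_homogeneous f"
  shows "dominion_condition f \<longleftrightarrow>
    (\<forall>I J. closed_class (log_conjugate f) I \<longrightarrow> closed_class (opposite (log_conjugate f)) J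
       \<longrightarrow> I \<inter> J \<noteq> {})"
proof -
  let ?T = "log_conjugate f"
  have T: "topical ?T" and T': "topical (opposite ?T)"
    using topical_log_conjugate[OF f] topical_opposite by blast+
  have UNIV: "UNIV \<in> min_actions f i" "UNIV \<in> max_actions f i" for i
    unfolding min_actions_iff[OF f] max_actions_iff[OF f] by (rule bounded_ray_UNIV)+
  have meet: "I \<inter> J \<noteq> {}" if "I \<in> min_actions f i" "J \<in> max_actions f i" for i I J
    using that unfolding min_actions_iff[OF f] max_actions_iff[OF f] by (rule bounded_rays_meet[OF T])
  have "dominion (min_actions f) (max_actions f) I \<longleftrightarrow> closed_class ?T I" for I
    unfolding closed_class_def min_actions_iff[OF f, symmetric]
  proof (rule dominion_iff)
    show "L \<in> min_actions f i" if "K \<in> min_actions f i" "K \<subseteq> L" for i K L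
      using that unfolding min_actions_iff[OF f] by (rule bounded_ray_mono[OF T])
  qed (use UNIV meet in auto)
  moreover have "dominion (max_actions f) (min_actions f) J \<longleftrightarrow> closed_class (opposite ?T) J" for J
    unfolding closed_class_def max_actions_iff[OF f, symmetric]
  proof (rule dominion_iff)
    show "L \<in> max_actions f i" if "K \<in> max_actions f i" "K \<subseteq> L" for i K L
      using that unfolding max_actions_iff[OF f] by (rule bounded_ray_mono[OF T'])
    show "K \<inter> L \<noteq> {}" if "K \<in> max_actions f i" "L \<in> min_actions f i" for i K L
      using meet[OF that(2,1)] by blast
  qed (use UNIV in auto)
  ultimately show ?thesis
    unfolding dominion_condition_def by blast
qed

lemma has_pos_eigenvector_iff:
  fixes f :: "real ^ 'n::finite \<Rightarrow> real ^ 'n"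
  assumes f: "order_homogeneous f"
  shows "has_pos_eigenvector f \<longleftrightarrow> (\<exists>u l. log_conjugate f u = u + vec l)"
proof
  assume "has_pos_eigenvector f"
  then obtain u l where u: "u \<in> pos_orthant" "0 < l" "f u = l *\<^sub>R u"
    by (auto simp: has_pos_eigenvector_def)
  define x where "x = (\<chi> i. ln (u $ i))"
  have "exp_vec x = u"
    using u(1) by (simp add: x_def exp_vec_def pos_orthant_def vec_eq_iff)
  then have "exp_vec (log_conjugate f x) = exp_vec (x + vec (ln l))"
    using u by (simp add: exp_log_conjugate[OF f] exp_vec_add)
  then show "\<exists>u l. log_conjugate f u = u + vec l"
    by (auto simp: exp_vec_inject)
next
  assume "\<exists>u l. log_conjugate f u = u + vec l"
  then obtain u l where "log_conjugate f u = u + vec l" by blast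
  then have "f (exp_vec u) = exp l *\<^sub>R exp_vec u"
    by (simp add: exp_log_conjugate[OF f, symmetric] exp_vec_add)
  then show "has_pos_eigenvector f"
    unfolding has_pos_eigenvector_def using exp_vec_pos exp_gt_zero by blast
qed


section \<open>Elementary properties of generalized means\<close>

lemma weight_outside_supp:
  assumes "stochastic \<sigma>" and "i < length \<sigma>" and "i \<notin> supp \<sigma>"
  shows "\<sigma> ! i = 0"
proof -
  have "0 \<le> \<sigma> ! i"
    using assms by (simp add: stochastic_def)
  then show ?thesis
    using assms by (simp add: supp_def)
qed

lemma supp_facts:
  assumes "stochastic \<sigma>"
  shows "finite (supp \<sigma>)" "supp \<sigma> \<noteq> {}" "(\<Sum>i\<in>supp \<sigma>. \<sigma> ! i) = 1"
    and "\<And>i. i \<in> supp \<sigma> \<Longrightarrow> 0 < \<sigma> ! i"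
proof -
  show fin: "finite (supp \<sigma>)" by (simp add: supp_def)
  show "\<And>i. i \<in> supp \<sigma> \<Longrightarrow> 0 < \<sigma> ! i" by (simp add: supp_def)
  have "(\<Sum>i\<in>supp \<sigma>. \<sigma> ! i) = (\<Sum>i<length \<sigma>. \<sigma> ! i)"
    using assms by (intro sum.mono_neutral_left) (auto simp: supp_def intro: weight_outside_supp[OF assms])
  also have "\<dots> = 1"
    using assms by (simp add: stochastic_def sum_list_sum_nth atLeast0LessThan)
  finally show *: "(\<Sum>i\<in>supp \<sigma>. \<sigma> ! i) = 1" .
  then show "supp \<sigma> \<noteq> {}" by auto
qed

text \<open>On positive arguments the special treatment of zeros disappears, and the sum can be restricted to the
  support.\<close>

lemma gmean_pos_args:
  assumes "stochastic \<sigma>" and "\<And>i. i \<in> supp \<sigma> \<Longrightarrow> 0 < x ! i"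
  shows "gmean (ereal p) \<sigma> x =
    (if p = 0 then \<Prod>i\<in>supp \<sigma>. (x ! i) powr (\<sigma> ! i)
     else (\<Sum>i\<in>supp \<sigma>. \<sigma> ! i * (x ! i) powr p) powr (1 / p))"
proof -
  have "(\<Sum>i\<in>supp \<sigma>. \<sigma> ! i * (x ! i) powr p) = (\<Sum>i<length \<sigma>. \<sigma> ! i * (x ! i) powr p)"
    using assms(1) by (intro sum.mono_neutral_left) (auto simp: supp_def weight_outside_supp)
  then show ?thesis
    using assms(2) by (fastforce simp: gmean_def)
qed

lemma weighted_power_sum_pos:
  assumes \<sigma>: "stochastic \<sigma>" and x: "\<And>i. i \<in> supp \<sigma> \<Longrightarrow> 0 < x ! i"
  shows "0 < (\<Sum>i\<in>supp \<sigma>. \<sigma> ! i * (x ! i) powr p)"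
proof (rule sum_pos)
  show "0 < \<sigma> ! i * (x ! i) powr p" if "i \<in> supp \<sigma>" for i
    using supp_facts(4)[OF \<sigma> that] x[OF that] by simp
qed (use supp_facts[OF \<sigma>] in auto)

lemma gmean_extreme:
  "gmean \<infinity> \<sigma> x = Max ((!) x ` supp \<sigma>)" "gmean (- \<infinity>) \<sigma> x = Min ((!) x ` supp \<sigma>)"
  by (simp_all only: gmean_def infinity_ereal_def uminus_ereal.simps ereal.case)

lemma gmean_pos:
  assumes \<sigma>: "stochastic \<sigma>" and x: "\<And>i. i \<in> supp \<sigma> \<Longrightarrow> 0 < x ! i"
  shows "0 < gmean r \<sigma> x"
proof (cases r)
  case (real p)
  have "0 < (\<Prod>i\<in>supp \<sigma>. (x ! i) powr (\<sigma> ! i))"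
    using x by (intro prod_pos) force
  with weighted_power_sum_pos[OF \<sigma> x, of p] show ?thesis
    by (simp add: real gmean_pos_args[OF \<sigma> x])
next
  case PInf
  obtain i where "i \<in> supp \<sigma>"
    using supp_facts(2)[OF \<sigma>] by blast
  then have "x ! i \<le> Max ((!) x ` supp \<sigma>)"
    using supp_facts(1)[OF \<sigma>] by (intro Max_ge) auto
  then show ?thesis
    using x[OF \<open>i \<in> supp \<sigma>\<close>] by (simp add: PInf gmean_extreme)
next
  case MInf
  then show ?thesis
    using supp_facts[OF \<sigma>] x by (auto simp: gmean_extreme(2))
qed

lemma gmean_mono:
  assumes \<sigma>: "stochastic \<sigma>" and x: "\<And>i. i \<in> supp \<sigma> \<Longrightarrow> 0 < x ! i"
    and le: "\<And>i. i \<in> supp \<sigma> \<Longrightarrow> x ! i \<le> y ! i"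
  shows "gmean r \<sigma> x \<le> gmean r \<sigma> y"
proof (cases r)
  case (real p)
  have y: "0 < y ! i" if "i \<in> supp \<sigma>" for i
    using x le that by (meson less_le_trans)
  consider "p = 0" | "0 < p" | "p < 0" by linarith
  then show ?thesis
  proof cases
    case 1
    have "(\<Prod>i\<in>supp \<sigma>. (x ! i) powr (\<sigma> ! i)) \<le> (\<Prod>i\<in>supp \<sigma>. (y ! i) powr (\<sigma> ! i))"
      using supp_facts(4)[OF \<sigma>] x le
      by (intro prod_mono conjI powr_mono2) (auto simp: less_imp_le)
    then show ?thesis
      using gmean_pos_args[OF \<sigma>, of x p] gmean_pos_args[OF \<sigma>, of y p] x y 1 by (simp add: real)
  next
    case 2
    have "(\<Sum>i\<in>supp \<sigma>. \<sigma> ! i * (x ! i) powr p) \<le> (\<Sum>i\<in>supp \<sigma>. \<sigma> ! i * (y ! i) powr p)"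
      using supp_facts[OF \<sigma>] x le 2 by (intro sum_mono mult_left_mono powr_mono2) (auto simp: less_imp_le)
    then show ?thesis
      using 2 weighted_power_sum_pos[OF \<sigma> x, of p] by (simp add: real gmean_pos_args[OF \<sigma> x] gmean_pos_args[OF \<sigma> y] powr_mono2)
  next
    case 3
    have "(\<Sum>i\<in>supp \<sigma>. \<sigma> ! i * (y ! i) powr p) \<le> (\<Sum>i\<in>supp \<sigma>. \<sigma> ! i * (x ! i) powr p)"
      using supp_facts[OF \<sigma>] x le 3 by (intro sum_mono mult_left_mono powr_mono2') (auto simp: less_imp_le)
    then show ?thesis
      using 3 weighted_power_sum_pos[OF \<sigma> y, of p] by (simp add: real gmean_pos_args[OF \<sigma> x] gmean_pos_args[OF \<sigma> y] powr_mono2')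
  qed
next
  case PInf
  have "x ! i \<le> Max ((!) y ` supp \<sigma>)" if "i \<in> supp \<sigma>" for i
    using le[OF that] supp_facts(1)[OF \<sigma>] that by (meson Max_ge finite_imageI imageI order_trans)
  then show ?thesis
    using supp_facts[OF \<sigma>] by (simp add: PInf gmean_extreme)
next
  case MInf
  have "Min ((!) x ` supp \<sigma>) \<le> y ! i" if "i \<in> supp \<sigma>" for i
    using le[OF that] supp_facts(1)[OF \<sigma>] that by (meson Min_le finite_imageI imageI order_trans)
  then show ?thesis
    using supp_facts[OF \<sigma>] by (simp add: MInf gmean_extreme(2))
qed

lemma gmean_const:
  assumes \<sigma>: "stochastic \<sigma>" and "0 < c" and x: "\<And>i. i \<in> supp \<sigma> \<Longrightarrow> x ! i = c"
  shows "gmean r \<sigma> x = c"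
proof (cases r)
  case (real p)
  have pos: "\<And>i. i \<in> supp \<sigma> \<Longrightarrow> 0 < x ! i"
    using x \<open>0 < c\<close> by simp
  have "(\<Prod>i\<in>supp \<sigma>. (x ! i) powr (\<sigma> ! i)) = c powr (\<Sum>i\<in>supp \<sigma>. \<sigma> ! i)"
    using x \<open>0 < c\<close> supp_facts(1)[OF \<sigma>] by (simp add: powr_sum cong: prod.cong)
  moreover have "(\<Sum>i\<in>supp \<sigma>. \<sigma> ! i * (x ! i) powr p) = c powr p"
    using x supp_facts(3)[OF \<sigma>] by (simp flip: sum_distrib_right cong: sum.cong)
  ultimately show ?thesis
    using \<open>0 < c\<close> supp_facts(3)[OF \<sigma>] by (simp add: real gmean_pos_args[OF \<sigma> pos] powr_powr)
next
  case PInf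
  have "(!) x ` supp \<sigma> = {c}"
    using x supp_facts(2)[OF \<sigma>] by force
  then show ?thesis by (simp add: PInf gmean_extreme)
next
  case MInf
  have "(!) x ` supp \<sigma> = {c}"
    using x supp_facts(2)[OF \<sigma>] by force
  then show ?thesis by (simp add: MInf gmean_extreme(2))
qed

lemma gmean_homogeneous:
  assumes \<sigma>: "stochastic \<sigma>" and "0 < c" and x: "\<And>i. i \<in> supp \<sigma> \<Longrightarrow> 0 < x ! i"
    and y: "\<And>i. i \<in> supp \<sigma> \<Longrightarrow> y ! i = c * x ! i"
  shows "gmean r \<sigma> y = c * gmean r \<sigma> x"
proof (cases r)
  case (real p)
  have pos: "\<And>i. i \<in> supp \<sigma> \<Longrightarrow> 0 < y ! i"
    using x y \<open>0 < c\<close> by simp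
  have "(\<Prod>i\<in>supp \<sigma>. (y ! i) powr (\<sigma> ! i))
      = (\<Prod>i\<in>supp \<sigma>. c powr (\<sigma> ! i)) * (\<Prod>i\<in>supp \<sigma>. (x ! i) powr (\<sigma> ! i))"
    unfolding prod.distrib[symmetric]
    using x y \<open>0 < c\<close> by (intro prod.cong refl) (simp add: powr_mult less_imp_le)
  also have "(\<Prod>i\<in>supp \<sigma>. c powr (\<sigma> ! i)) = c"
    using \<open>0 < c\<close> supp_facts[OF \<sigma>] by (simp flip: powr_sum)
  finally have "(\<Prod>i\<in>supp \<sigma>. (y ! i) powr (\<sigma> ! i)) = c * (\<Prod>i\<in>supp \<sigma>. (x ! i) powr (\<sigma> ! i))" .
  moreover have "(\<Sum>i\<in>supp \<sigma>. \<sigma> ! i * (y ! i) powr p) = c powr p * (\<Sum>i\<in>supp \<sigma>. \<sigma> ! i * (x ! i) powr p)"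
    unfolding sum_distrib_left
    using x y \<open>0 < c\<close> by (intro sum.cong refl) (simp add: powr_mult less_imp_le)
  moreover have "0 \<le> (\<Sum>i\<in>supp \<sigma>. \<sigma> ! i * (x ! i) powr p)"
    using supp_facts(4)[OF \<sigma>] by (intro sum_nonneg) (simp add: less_imp_le)
  ultimately show ?thesis
    using \<open>0 < c\<close> by (simp add: real gmean_pos_args[OF \<sigma> pos] gmean_pos_args[OF \<sigma> x] powr_mult powr_powr)
next
  case PInf
  have "mono ((*) c)"
    using \<open>0 < c\<close> by (simp add: mono_def)
  moreover have "(!) y ` supp \<sigma> = (*) c ` ((!) x ` supp \<sigma>)"
    using y by (auto simp: image_image)
  ultimately show ?thesis
    using supp_facts[OF \<sigma>] by (simp add: PInf gmean_extreme mono_Max_commute)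
next
  case MInf
  have "mono ((*) c)"
    using \<open>0 < c\<close> by (simp add: mono_def)
  moreover have "(!) y ` supp \<sigma> = (*) c ` ((!) x ` supp \<sigma>)"
    using y by (auto simp: image_image)
  ultimately show ?thesis
    using supp_facts[OF \<sigma>] by (simp add: MInf gmean_extreme(2) mono_Min_commute)
qed

lemma Max_inverse:
  fixes A :: "real set"
  assumes "finite A" "A \<noteq> {}" and "\<And>a. a \<in> A \<Longrightarrow> 0 < a"
  shows "Max (inverse ` A) = inverse (Min A)"
proof (rule Max_eqI)
  have "0 < Min A"
    using assms Min_in by blast
  then show "y \<le> inverse (Min A)" if "y \<in> inverse ` A" for y
    using assms(1) that by (auto intro!: le_imp_inverse_le)
  show "inverse (Min A) \<in> inverse ` A"
    using assms by simp
qed (use assms in simp)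

text \<open>This is what makes the class stable under the exchange of the two players: taking reciprocals
  of the arguments and of the value changes the order \<open>r\<close> of a mean into \<open>- r\<close>.\<close>

lemma gmean_inverse:
  assumes \<sigma>: "stochastic \<sigma>" and x: "\<And>i. i \<in> supp \<sigma> \<Longrightarrow> 0 < x ! i"
    and y: "\<And>i. i \<in> supp \<sigma> \<Longrightarrow> y ! i = inverse (x ! i)"
  shows "gmean (- r) \<sigma> y = inverse (gmean r \<sigma> x)"
proof (cases r)
  case (real p)
  have pos: "\<And>i. i \<in> supp \<sigma> \<Longrightarrow> 0 < y ! i"
    using x y by simp
  have "(\<Prod>i\<in>supp \<sigma>. (y ! i) powr (\<sigma> ! i)) = inverse (\<Prod>i\<in>supp \<sigma>. (x ! i) powr (\<sigma> ! i))"
    unfolding prod_inversef[symmetric]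
    using y by (intro prod.cong refl) (simp add: inverse_powr o_def)
  moreover have "(\<Sum>i\<in>supp \<sigma>. \<sigma> ! i * (y ! i) powr - p) = (\<Sum>i\<in>supp \<sigma>. \<sigma> ! i * (x ! i) powr p)"
    using x y by (intro sum.cong refl) (simp add: inverse_powr powr_minus)
  ultimately show ?thesis
    by (simp add: real gmean_pos_args[OF \<sigma> pos] gmean_pos_args[OF \<sigma> x] powr_minus)
next
  case PInf
  have "(!) x ` supp \<sigma> = inverse ` (!) y ` supp \<sigma>"
    using y by (auto simp: image_image)
  then have "Max ((!) x ` supp \<sigma>) = inverse (Min ((!) y ` supp \<sigma>))"
    using supp_facts[OF \<sigma>] x y by (simp only:) (rule Max_inverse, auto)
  then show ?thesis
    by (simp add: PInf gmean_extreme(1) gmean_extreme(2)[simplified])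
next
  case MInf
  have "(!) y ` supp \<sigma> = inverse ` (!) x ` supp \<sigma>"
    using y by (auto simp: image_image)
  then have "Max ((!) y ` supp \<sigma>) = inverse (Min ((!) x ` supp \<sigma>))"
    using supp_facts[OF \<sigma>] x y by (simp only:) (rule Max_inverse, auto)
  then show ?thesis
    by (simp add: MInf gmean_extreme(1) gmean_extreme(2)[simplified])
qed

text \<open>Keep the single term \<open>\<sigma>\<^sub>i x\<^sub>i\<^sup>r\<close> of the sum when \<open>r\<close> is finite. So a mean of positive order cannot tend to \<open>0\<close> unless all
  its arguments in the support do.\<close>

lemma gmean_ge_multiple_of_argument:
  assumes \<sigma>: "stochastic \<sigma>" and i: "i \<in> supp \<sigma>" and "0 < r"
  shows "\<exists>c>0. \<forall>x. (\<forall>j\<in>supp \<sigma>. 0 < x ! j) \<longrightarrow> c * x ! i \<le> gmean r \<sigma> x"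
proof (cases r)
  case (real p)
  then have "0 < p" using \<open>0 < r\<close> by simp
  have "(\<sigma> ! i) powr (1 / p) * x ! i \<le> gmean r \<sigma> x" if x: "\<And>j. j \<in> supp \<sigma> \<Longrightarrow> 0 < x ! j" for x
  proof -
    have "(\<sigma> ! i) powr (1 / p) * x ! i = (\<sigma> ! i * (x ! i) powr p) powr (1 / p)"
      using supp_facts(4)[OF \<sigma> i] x[OF i] \<open>0 < p\<close> by (simp add: powr_mult powr_powr)
    also have "\<dots> \<le> (\<Sum>j\<in>supp \<sigma>. \<sigma> ! j * (x ! j) powr p) powr (1 / p)"
    proof (rule powr_mono2)
      show "\<sigma> ! i * (x ! i) powr p \<le> (\<Sum>j\<in>supp \<sigma>. \<sigma> ! j * (x ! j) powr p)"
        by (rule member_le_sum[OF i]) (use supp_facts[OF \<sigma>] in \<open>auto simp: less_imp_le\<close>)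
    qed (use \<open>0 < p\<close> supp_facts(4)[OF \<sigma> i] in auto)
    finally show ?thesis
      using \<open>0 < p\<close> by (simp add: real gmean_pos_args[OF \<sigma> x])
  qed
  moreover have "0 < (\<sigma> ! i) powr (1 / p)"
    using supp_facts(4)[OF \<sigma> i] by simp
  ultimately show ?thesis by blast
next
  case PInf
  have "1 * x ! i \<le> gmean r \<sigma> x" for x
    using supp_facts(1)[OF \<sigma>] i by (simp add: PInf gmean_extreme)
  then show ?thesis using zero_less_one by blast
qed (use \<open>0 < r\<close> in simp)

text \<open>The reciprocal of the previous bound: a mean of negative order tends to \<open>0\<close> as soon as one
  argument in the support does.\<close>

lemma gmean_le_multiple_of_argument:
  assumes \<sigma>: "stochastic \<sigma>" and i: "i \<in> supp \<sigma>" and "r < 0"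
  shows "\<exists>C. \<forall>x. (\<forall>j\<in>supp \<sigma>. 0 < x ! j) \<longrightarrow> gmean r \<sigma> x \<le> C * x ! i"
proof -
  have "0 < - r"
    using \<open>r < 0\<close> by (cases r) auto
  then obtain c where c: "0 < c" "\<And>x. (\<forall>j\<in>supp \<sigma>. 0 < x ! j) \<Longrightarrow> c * x ! i \<le> gmean (- r) \<sigma> x"
    using gmean_ge_multiple_of_argument[OF \<sigma> i] by blast
  have "gmean r \<sigma> x \<le> inverse c * x ! i" if x: "\<And>j. j \<in> supp \<sigma> \<Longrightarrow> 0 < x ! j" for x
  proof -
    define y where "y = map (\<lambda>j. inverse (x ! j)) [0..<length \<sigma>]"
    have y: "y ! j = inverse (x ! j)" if "j \<in> supp \<sigma>" for j
      using that by (simp add: y_def supp_def)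
    have "c * y ! i \<le> gmean (- r) \<sigma> y"
      using x y by (intro c(2)) simp
    also have "\<dots> = inverse (gmean r \<sigma> x)"
      using x y by (rule gmean_inverse[OF \<sigma>])
    finally have "c * inverse (x ! i) \<le> inverse (gmean r \<sigma> x)"
      using y[OF i] by simp
    then show ?thesis
      using gmean_pos[OF \<sigma> x, of r] x[OF i] c(1) by (simp add: field_simps)
  qed
  then show ?thesis by blast
qed

text \<open>For the geometric mean this still holds, provided that the other arguments remain bounded; the bound
  is then a positive power of the vanishing argument.\<close>

lemma geometric_mean_le_power_of_argument:
  assumes \<sigma>: "stochastic \<sigma>" and i: "i \<in> supp \<sigma>"
    and x: "\<And>j. j \<in> supp \<sigma> \<Longrightarrow> 0 < x ! j" "\<And>j. j \<in> supp \<sigma> \<Longrightarrow> x ! j \<le> B j"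
  shows "gmean 0 \<sigma> x \<le> (x ! i) powr (\<sigma> ! i) * (\<Prod>j\<in>supp \<sigma> - {i}. B j powr (\<sigma> ! j))"
proof -
  have "gmean 0 \<sigma> x = (x ! i) powr (\<sigma> ! i) * (\<Prod>j\<in>supp \<sigma> - {i}. (x ! j) powr (\<sigma> ! j))"
    using gmean_pos_args[OF \<sigma> x(1), of 0] prod.remove[OF supp_facts(1)[OF \<sigma>] i]
    by (simp flip: zero_ereal_def)
  also have "\<dots> \<le> (x ! i) powr (\<sigma> ! i) * (\<Prod>j\<in>supp \<sigma> - {i}. B j powr (\<sigma> ! j))"
    using x supp_facts(4)[OF \<sigma>]
    by (intro mult_left_mono prod_mono conjI powr_mono2) (auto simp: less_imp_le)
  finally show ?thesis .
qed


section \<open>Maps defined by expressions\<close>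

lemma supp_nth_mem:
  assumes "length es = length \<sigma>" and "i \<in> supp \<sigma>"
  shows "i < length es" "es ! i \<in> set es"
  using assms by (auto simp: supp_def)

lemma eval_mexpr_pos:
  assumes "wf_mexpr e" and "x \<in> pos_orthant"
  shows "0 < eval_mexpr e x"
  using assms
proof (induction e)
  case (Mean r \<sigma> es)
  then have len: "length es = length \<sigma>" and \<sigma>: "stochastic \<sigma>" by auto
  have "0 < map (\<lambda>e. eval_mexpr e x) es ! i" if "i \<in> supp \<sigma>" for i
    using supp_nth_mem[OF len that] Mean by auto
  then show ?case
    using gmean_pos[OF \<sigma>] by simp
qed (auto simp: pos_orthant_def)

lemma eval_mexpr_mono:
  assumes "wf_mexpr e" and "x \<in> pos_orthant" and "y \<in> pos_orthant" and "x \<le> y"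
  shows "eval_mexpr e x \<le> eval_mexpr e y"
  using assms(1)
proof (induction e)
  case (Var i)
  then show ?case using \<open>x \<le> y\<close> by (simp add: less_eq_vec_def)
next
  case (Mean r \<sigma> es)
  then have len: "length es = length \<sigma>" and \<sigma>: "stochastic \<sigma>" by auto
  have "gmean r \<sigma> (map (\<lambda>e. eval_mexpr e x) es) \<le> gmean r \<sigma> (map (\<lambda>e. eval_mexpr e y) es)"
  proof (rule gmean_mono[OF \<sigma>])
    fix i assume "i \<in> supp \<sigma>"
    from supp_nth_mem[OF len this] Mean
    show "0 < map (\<lambda>e. eval_mexpr e x) es ! i"
      "map (\<lambda>e. eval_mexpr e x) es ! i \<le> map (\<lambda>e. eval_mexpr e y) es ! i"
      using eval_mexpr_pos[OF _ assms(2)] by auto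
  qed
  then show ?case by simp
qed (simp add: mult_left_mono)

lemma eval_mexpr_homogeneous:
  assumes "wf_mexpr e" and "x \<in> pos_orthant" and "0 < c"
  shows "eval_mexpr e (c *\<^sub>R x) = c * eval_mexpr e x"
  using assms(1)
proof (induction e)
  case (Mean r \<sigma> es)
  then have len: "length es = length \<sigma>" and \<sigma>: "stochastic \<sigma>" by auto
  have "gmean r \<sigma> (map (\<lambda>e. eval_mexpr e (c *\<^sub>R x)) es) = c * gmean r \<sigma> (map (\<lambda>e. eval_mexpr e x) es)"
  proof (rule gmean_homogeneous[OF \<sigma> \<open>0 < c\<close>])
    fix i assume "i \<in> supp \<sigma>"
    from supp_nth_mem[OF len this] Mean
    show "0 < map (\<lambda>e. eval_mexpr e x) es ! i"
      "map (\<lambda>e. eval_mexpr e (c *\<^sub>R x)) es ! i = c * map (\<lambda>e. eval_mexpr e x) es ! i"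
      using eval_mexpr_pos[OF _ assms(2)] by auto
  qed
  then show ?case by simp
qed simp_all

lemma vexpr_map_pos:
  assumes "x \<in> pos_orthant"
  shows "vexpr_map E x $ i = eval_mexpr (E i) x"
  using assms by (simp add: vexpr_map_def nonneg_orthant_def pos_orthant_def less_imp_le)

lemma order_homogeneous_vexpr_map:
  fixes E :: "'n::finite \<Rightarrow> 'n mexpr"
  assumes "wf_vexpr E"
  shows "order_homogeneous (vexpr_map E)"
proof -
  have wf: "wf_mexpr (E i)" for i
    using assms by (simp add: wf_vexpr_def)
  have scale: "c *\<^sub>R x \<in> pos_orthant" if "x \<in> pos_orthant" "0 < c" for c and x :: "real ^ 'n"
    using that by (simp add: pos_orthant_def)
  show ?thesis
    unfolding order_homogeneous_def
  proof (intro conjI ballI allI impI)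
    show "vexpr_map E x \<in> pos_orthant" if "x \<in> pos_orthant" for x
      unfolding pos_orthant_def using that by (simp add: vexpr_map_pos eval_mexpr_pos wf)
    show "vexpr_map E x \<le> vexpr_map E y"
      if "x \<in> pos_orthant" "y \<in> pos_orthant" "x \<le> y" for x y
      using that by (simp add: less_eq_vec_def[of "vexpr_map E x"] vexpr_map_pos eval_mexpr_mono wf)
    show "vexpr_map E (c *\<^sub>R x) = c *\<^sub>R vexpr_map E x" if "x \<in> pos_orthant" "0 < c" for x c
      using that by (simp add: vec_eq_iff vexpr_map_pos scale eval_mexpr_homogeneous wf)
  qed
qed


section \<open>The game depends only on the signature\<close>

text \<open>Whether an expression tends to \<open>0\<close> when the variables in \<open>K\<close> do and the others equal \<open>1\<close>. Of a mean, only
  the support and whether its order is positive are used.\<close>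

primrec vanishes :: "'n set \<Rightarrow> 'n mexpr \<Rightarrow> bool" where
  "vanishes K (Var j) \<longleftrightarrow> j \<in> K"
| "vanishes K (Scale c e) \<longleftrightarrow> vanishes K e"
| "vanishes K (Mean r \<sigma> es) \<longleftrightarrow>
    (if 0 < r then \<forall>i\<in>supp \<sigma>. map (vanishes K) es ! i else \<exists>i\<in>supp \<sigma>. map (vanishes K) es ! i)"

primrec reciprocal_mexpr :: "'n mexpr \<Rightarrow> 'n mexpr" where
  "reciprocal_mexpr (Var j) = Var j"
| "reciprocal_mexpr (Scale c e) = Scale (inverse c) (reciprocal_mexpr e)"
| "reciprocal_mexpr (Mean r \<sigma> es) = Mean (- r) \<sigma> (map reciprocal_mexpr es)"

lemma wf_reciprocal_mexpr: "wf_mexpr e \<Longrightarrow> wf_mexpr (reciprocal_mexpr e)"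
  by (induction e) auto

lemma eval_reciprocal_mexpr:
  assumes "wf_mexpr e"
  shows "eval_mexpr (reciprocal_mexpr e) (exp_vec (- x)) = inverse (eval_mexpr e (exp_vec x))"
  using assms
proof (induction e)
  case (Var i)
  then show ?case by (simp add: exp_vec_def exp_minus)
next
  case (Mean r \<sigma> es)
  then have len: "length es = length \<sigma>" and \<sigma>: "stochastic \<sigma>" by auto
  have "gmean (- r) \<sigma> (map (\<lambda>e. eval_mexpr e (exp_vec (- x))) (map reciprocal_mexpr es))
      = inverse (gmean r \<sigma> (map (\<lambda>e. eval_mexpr e (exp_vec x)) es))"
  proof (rule gmean_inverse[OF \<sigma>])
    fix i assume "i \<in> supp \<sigma>"
    then have "wf_mexpr (es ! i)"
      using supp_nth_mem[OF len] Mean.prems by simp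
    then have "0 < eval_mexpr (es ! i) (exp_vec x)"
      by (rule eval_mexpr_pos[OF _ exp_vec_pos])
    with supp_nth_mem[OF len \<open>i \<in> supp \<sigma>\<close>] Mean
    show "0 < map (\<lambda>e. eval_mexpr e (exp_vec x)) es ! i"
      "map (\<lambda>e. eval_mexpr e (exp_vec (- x))) (map reciprocal_mexpr es) ! i
        = inverse (map (\<lambda>e. eval_mexpr e (exp_vec x)) es ! i)"
      by auto
  qed
  then show ?case by (simp add: o_def)
qed simp

lemma uniform_weights_facts:
  assumes \<sigma>: "stochastic \<sigma>"
  shows "supp (uniform_weights \<sigma>) = supp \<sigma>" "stochastic (uniform_weights \<sigma>)"
    "length (uniform_weights \<sigma>) = length \<sigma>"
proof -
  let ?c = "1 / real (card (supp \<sigma>))"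
  have "card (supp \<sigma>) \<noteq> 0"
    using supp_facts(1,2)[OF \<sigma>] by simp
  then have "0 < ?c"
    by simp
  then have weight: "0 < uniform_weights \<sigma> ! i \<longleftrightarrow> 0 < \<sigma> ! i" if "i < length \<sigma>" for i
    using that by (simp add: uniform_weights_def)
  show len: "length (uniform_weights \<sigma>) = length \<sigma>"
    by (simp add: uniform_weights_def)
  show "supp (uniform_weights \<sigma>) = supp \<sigma>"
    using weight by (auto simp: supp_def[of \<sigma>] supp_def[of "uniform_weights \<sigma>"] len)
  have "sum_list (uniform_weights \<sigma>) = (\<Sum>i<length \<sigma>. if i \<in> supp \<sigma> then ?c else 0)"
    by (auto simp: sum_list_sum_nth uniform_weights_def supp_def atLeast0LessThan intro!: sum.cong)
  also have "\<dots> = (\<Sum>i\<in>supp \<sigma>. ?c)"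
    by (intro sum.mono_neutral_cong_right) (auto simp: supp_def)
  also have "\<dots> = 1"
    using \<open>card (supp \<sigma>) \<noteq> 0\<close> by simp
  finally show "stochastic (uniform_weights \<sigma>)"
    by (auto simp: stochastic_def uniform_weights_def)
qed

lemma wf_sig_mexpr: "wf_mexpr e \<Longrightarrow> wf_mexpr (sig_mexpr e)"
  by (induction e) (auto simp: uniform_weights_facts)

lemma sig_reciprocal_mexpr: "sig_mexpr (reciprocal_mexpr e) = reciprocal_mexpr (sig_mexpr e)"
proof (induction e)
  case (Mean r \<sigma> es)
  have "0 < - r \<longleftrightarrow> r < 0" "- r < 0 \<longleftrightarrow> 0 < r"
    by (cases r; simp)+
  with Mean show ?case by auto
qed auto

lemma vanishes_sig_mexpr: "wf_mexpr e \<Longrightarrow> vanishes K (sig_mexpr e) \<longleftrightarrow> vanishes K e"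
proof (induction e)
  case (Mean r \<sigma> es)
  then have len: "length es = length \<sigma>" and \<sigma>: "stochastic \<sigma>" by auto
  have "map (vanishes K) (map sig_mexpr es) ! i = map (vanishes K) es ! i" if "i \<in> supp \<sigma>" for i
    using supp_nth_mem[OF len that] Mean by auto
  then show ?case
    by (auto simp: uniform_weights_facts[OF \<sigma>])
qed auto

text \<open>By induction on the expression. For a mean, if no argument vanishes, all of them exceed a constant
  and so does the mean, whatever its order. Otherwise, the means of positive order are squeezed between a
  multiple of any one argument and the largest argument, while those of order \<open>\<le> 0\<close> are bounded above
  in terms of a single vanishing argument. For order \<open>0\<close> the other arguments must be bounded, which
  monotonicity ensures: for \<open>\<alpha> \<le> 0\<close> they do not exceed their value at the vector of ones.\<close>

lemma vanishing_dichotomy: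
  fixes e :: "'n::finite mexpr"
  assumes "wf_mexpr e"
  shows "(vanishes K e \<longrightarrow> ((\<lambda>\<alpha>. eval_mexpr e (exp_vec (ray K \<alpha>))) \<longlongrightarrow> 0) at_bot) \<and>
    (\<not> vanishes K e \<longrightarrow> (\<exists>c>0. \<forall>\<^sub>F \<alpha> in at_bot. c \<le> eval_mexpr e (exp_vec (ray K \<alpha>))))"
  using assms
proof (induction e)
  case (Var j)
  have "((\<lambda>\<alpha>. exp \<alpha>) \<longlongrightarrow> (0::real)) at_bot"
    by (rule exp_at_bot)
  then show ?case
    by (auto simp: exp_vec_def ray_def intro!: exI[of _ 1])
next
  case (Scale d e)
  let ?\<phi> = "\<lambda>\<alpha>. eval_mexpr e (exp_vec (ray K \<alpha>))"
  have d: "0 < d" and IH: "vanishes K e \<longrightarrow> (?\<phi> \<longlongrightarrow> 0) at_bot"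
      "\<not> vanishes K e \<longrightarrow> (\<exists>c>0. \<forall>\<^sub>F \<alpha> in at_bot. c \<le> ?\<phi> \<alpha>)"
    using Scale by auto
  have "(?\<phi> \<longlongrightarrow> 0) at_bot \<Longrightarrow> ((\<lambda>\<alpha>. d * ?\<phi> \<alpha>) \<longlongrightarrow> 0) at_bot"
    by (rule tendsto_mult_right_zero)
  moreover have "\<exists>c>0. \<forall>\<^sub>F \<alpha> in at_bot. c \<le> d * ?\<phi> \<alpha>"
    if below: "\<exists>c>0. \<forall>\<^sub>F \<alpha> in at_bot. c \<le> ?\<phi> \<alpha>"
  proof -
    obtain c where c: "0 < c" "\<forall>\<^sub>F \<alpha> in at_bot. c \<le> ?\<phi> \<alpha>"
      using below by blast
    have "\<forall>\<^sub>F \<alpha> in at_bot. d * c \<le> d * ?\<phi> \<alpha>"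
      using c(2) d by simp
    then show ?thesis
      using c(1) d mult_pos_pos by blast
  qed
  ultimately show ?case
    using IH by simp
next
  case (Mean r \<sigma> es)
  then have len: "length es = length \<sigma>" and \<sigma>: "stochastic \<sigma>" by auto
  let ?\<phi> = "\<lambda>i \<alpha>. eval_mexpr (es ! i) (exp_vec (ray K \<alpha>))"
  let ?x = "\<lambda>\<alpha>. map (\<lambda>e. eval_mexpr e (exp_vec (ray K \<alpha>))) es"
  have wf: "wf_mexpr (es ! i)" if "i \<in> supp \<sigma>" for i
    using Mean supp_nth_mem[OF len that] by simp
  have x: "?x \<alpha> ! i = ?\<phi> i \<alpha>" if "i \<in> supp \<sigma>" for i \<alpha>
    using supp_nth_mem[OF len that] by simp
  have pos: "0 < ?x \<alpha> ! i" if "i \<in> supp \<sigma>" for i \<alpha>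
    using x that wf eval_mexpr_pos exp_vec_pos by metis
  have gpos: "0 < gmean r \<sigma> (?x \<alpha>)" for \<alpha>
    using gmean_pos[OF \<sigma> pos] .
  have van: "map (vanishes K) es ! i \<longleftrightarrow> vanishes K (es ! i)" if "i \<in> supp \<sigma>" for i
    using supp_nth_mem[OF len that] by simp
  have zero: "(?\<phi> i \<longlongrightarrow> 0) at_bot" if "i \<in> supp \<sigma>" "vanishes K (es ! i)" for i
    using Mean.IH[OF supp_nth_mem(2)[OF len that(1)] wf[OF that(1)]] that by blast
  have nonzero: "\<exists>c>0. \<forall>\<^sub>F \<alpha> in at_bot. c \<le> ?\<phi> i \<alpha>" if "i \<in> supp \<sigma>" "\<not> vanishes K (es ! i)" for i
    using Mean.IH[OF supp_nth_mem(2)[OF len that(1)] wf[OF that(1)]] that by blast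
  have le_at_ones: "\<forall>\<^sub>F \<alpha> in at_bot. ?x \<alpha> ! i \<le> eval_mexpr (es ! i) (exp_vec 0)" if "i \<in> supp \<sigma>" for i
    using eventually_le_at_bot[of 0]
  proof eventually_elim
    case (elim \<alpha>)
    then have "exp_vec (ray K \<alpha>) \<le> exp_vec 0"
      unfolding exp_vec_mono by (simp add: less_eq_vec_def ray_def indicator_def)
    then show ?case
      unfolding x[OF that] by (intro eval_mexpr_mono wf[OF that] exp_vec_pos)
  qed
  have all_nonzero: "\<exists>c>0. \<forall>\<^sub>F \<alpha> in at_bot. c \<le> gmean r \<sigma> (?x \<alpha>)"
    if nv: "\<And>i. i \<in> supp \<sigma> \<Longrightarrow> \<not> vanishes K (es ! i)"
  proof -
    obtain c where c: "\<And>i. i \<in> supp \<sigma> \<Longrightarrow> 0 < c i"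
        "\<And>i. i \<in> supp \<sigma> \<Longrightarrow> \<forall>\<^sub>F \<alpha> in at_bot. c i \<le> ?\<phi> i \<alpha>"
      using nonzero[OF _ nv] by metis
    define d where "d = Min (c ` supp \<sigma>)"
    have "0 < d" and d: "\<And>i. i \<in> supp \<sigma> \<Longrightarrow> d \<le> c i"
      using supp_facts(1,2)[OF \<sigma>] c(1) by (auto simp: d_def)
    have "\<forall>\<^sub>F \<alpha> in at_bot. \<forall>i\<in>supp \<sigma>. c i \<le> ?\<phi> i \<alpha>"
      using c(2) supp_facts(1)[OF \<sigma>] by (intro eventually_ball_finite) auto
    then have "\<forall>\<^sub>F \<alpha> in at_bot. d \<le> gmean r \<sigma> (?x \<alpha>)"
    proof eventually_elim
      case (elim \<alpha>)
      let ?d = "replicate (length es) d"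
      have "gmean r \<sigma> ?d \<le> gmean r \<sigma> (?x \<alpha>)"
      proof (rule gmean_mono[OF \<sigma>])
        fix i assume i: "i \<in> supp \<sigma>"
        show "0 < ?d ! i"
          using \<open>0 < d\<close> supp_nth_mem(1)[OF len i] by simp
        show "?d ! i \<le> ?x \<alpha> ! i"
          using d[OF i] elim i supp_nth_mem(1)[OF len i] by fastforce
      qed
      moreover have "gmean r \<sigma> ?d = d"
        by (rule gmean_const[OF \<sigma> \<open>0 < d\<close>]) (simp add: supp_nth_mem(1)[OF len])
      ultimately show ?case by simp
    qed
    then show ?thesis using \<open>0 < d\<close> by blast
  qed
  have small: "((\<lambda>\<alpha>. gmean r \<sigma> (?x \<alpha>)) \<longlongrightarrow> 0) at_bot"
    if "\<forall>\<^sub>F \<alpha> in at_bot. gmean r \<sigma> (?x \<alpha>) \<le> b \<alpha>" "(b \<longlongrightarrow> 0) at_bot" for b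
    using that gpos by (intro real_tendsto_sandwich[OF _ that(1) tendsto_const that(2)]) (auto intro!: always_eventually less_imp_le)
  consider "0 < r" | "r < 0" | "r = 0" by (metis less_linear)
  then have "(vanishes K (Mean r \<sigma> es) \<longrightarrow> ((\<lambda>\<alpha>. gmean r \<sigma> (?x \<alpha>)) \<longlongrightarrow> 0) at_bot) \<and>
    (\<not> vanishes K (Mean r \<sigma> es) \<longrightarrow> (\<exists>c>0. \<forall>\<^sub>F \<alpha> in at_bot. c \<le> gmean r \<sigma> (?x \<alpha>)))"
  proof cases
    case 1
    have "((\<lambda>\<alpha>. gmean r \<sigma> (?x \<alpha>)) \<longlongrightarrow> 0) at_bot" if "\<And>i. i \<in> supp \<sigma> \<Longrightarrow> vanishes K (es ! i)"
    proof (rule order_tendstoI)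
      fix a :: real assume "0 < a"
      have "\<forall>\<^sub>F \<alpha> in at_bot. \<forall>i\<in>supp \<sigma>. ?\<phi> i \<alpha> < a / 2"
        using order_tendstoD(2)[OF zero, of _ "a / 2"] that \<open>0 < a\<close> supp_facts(1)[OF \<sigma>]
        by (intro eventually_ball_finite) auto
      then show "\<forall>\<^sub>F \<alpha> in at_bot. gmean r \<sigma> (?x \<alpha>) < a"
      proof eventually_elim
        case (elim \<alpha>)
        let ?a = "replicate (length es) (a / 2)"
        have "gmean r \<sigma> (?x \<alpha>) \<le> gmean r \<sigma> ?a"
        proof (rule gmean_mono[OF \<sigma> pos])
          show "?x \<alpha> ! i \<le> ?a ! i" if "i \<in> supp \<sigma>" for i
            using elim that supp_nth_mem(1)[OF len that] by (simp add: less_imp_le)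
        qed
        also have "gmean r \<sigma> ?a = a / 2"
          using \<open>0 < a\<close> by (intro gmean_const[OF \<sigma>]) (auto simp: supp_nth_mem(1)[OF len])
        also have "a / 2 < a" using \<open>0 < a\<close> by simp
        finally show ?case .
      qed
    qed (use gpos less_trans in \<open>blast intro: always_eventually\<close>)
    moreover have "\<exists>c>0. \<forall>\<^sub>F \<alpha> in at_bot. c \<le> gmean r \<sigma> (?x \<alpha>)"
      if i: "i \<in> supp \<sigma>" and nv: "\<not> vanishes K (es ! i)" for i
    proof -
      obtain c where c: "0 < c" "\<forall>\<^sub>F \<alpha> in at_bot. c \<le> ?\<phi> i \<alpha>"
        using nonzero[OF i nv] by blast
      obtain d where d: "0 < d" "\<And>x. (\<forall>j\<in>supp \<sigma>. 0 < x ! j) \<Longrightarrow> d * x ! i \<le> gmean r \<sigma> x"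
        using gmean_ge_multiple_of_argument[OF \<sigma> i 1] by blast
      have "\<forall>\<^sub>F \<alpha> in at_bot. d * c \<le> gmean r \<sigma> (?x \<alpha>)"
        using c(2)
      proof eventually_elim
        case (elim \<alpha>)
        then have "d * c \<le> d * ?x \<alpha> ! i"
          using d(1) x[OF i] by simp
        also have "\<dots> \<le> gmean r \<sigma> (?x \<alpha>)"
          by (rule d(2)) (use pos in blast)
        finally show ?case .
      qed
      then show ?thesis using c(1) d(1) mult_pos_pos by blast
    qed
    ultimately show ?thesis
      using 1 van by (simp del: nth_map) blast
  next
    case 2
    have "((\<lambda>\<alpha>. gmean r \<sigma> (?x \<alpha>)) \<longlongrightarrow> 0) at_bot" if i: "i \<in> supp \<sigma>" and v: "vanishes K (es ! i)" for i
    proof -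
      obtain C where C: "\<And>x. (\<forall>j\<in>supp \<sigma>. 0 < x ! j) \<Longrightarrow> gmean r \<sigma> x \<le> C * x ! i"
        using gmean_le_multiple_of_argument[OF \<sigma> i 2] by blast
      show ?thesis
      proof (rule small)
        show "\<forall>\<^sub>F \<alpha> in at_bot. gmean r \<sigma> (?x \<alpha>) \<le> C * ?\<phi> i \<alpha>"
          unfolding x[OF i, symmetric] by (intro always_eventually allI C) (use pos in blast)
        show "((\<lambda>\<alpha>. C * ?\<phi> i \<alpha>) \<longlongrightarrow> 0) at_bot"
          by (rule tendsto_mult_right_zero[OF zero[OF i v]])
      qed
    qed
    then show ?thesis
      using 2 van all_nonzero by (simp del: nth_map) (meson less_asym)
  next
    case 3
    have "((\<lambda>\<alpha>. gmean r \<sigma> (?x \<alpha>)) \<longlongrightarrow> 0) at_bot" if i: "i \<in> supp \<sigma>" and v: "vanishes K (es ! i)" for i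
    proof (rule small)
      let ?B = "\<lambda>j. eval_mexpr (es ! j) (exp_vec 0)"
      let ?C = "\<Prod>j\<in>supp \<sigma> - {i}. ?B j powr (\<sigma> ! j)"
      have "\<forall>\<^sub>F \<alpha> in at_bot. \<forall>j\<in>supp \<sigma>. ?x \<alpha> ! j \<le> ?B j"
        using le_at_ones supp_facts(1)[OF \<sigma>] by (intro eventually_ball_finite) auto
      then show "\<forall>\<^sub>F \<alpha> in at_bot. gmean r \<sigma> (?x \<alpha>) \<le> ?\<phi> i \<alpha> powr (\<sigma> ! i) * ?C"
      proof eventually_elim
        case (elim \<alpha>)
        have "gmean 0 \<sigma> (?x \<alpha>) \<le> (?x \<alpha> ! i) powr (\<sigma> ! i) * ?C"
          using pos elim by (intro geometric_mean_le_power_of_argument[OF \<sigma> i]) blast+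
        then show ?case using 3 x[OF i] by simp
      qed
      have "((\<lambda>\<alpha>. ?\<phi> i \<alpha> powr (\<sigma> ! i)) \<longlongrightarrow> 0 powr (\<sigma> ! i)) at_bot"
      proof (rule tendsto_powr2[OF zero[OF i v] tendsto_const])
        show "\<forall>\<^sub>F \<alpha> in at_bot. 0 \<le> ?\<phi> i \<alpha>"
          using pos[OF i] x[OF i] by (simp add: less_imp_le)
      qed (rule supp_facts(4)[OF \<sigma> i])
      then show "((\<lambda>\<alpha>. ?\<phi> i \<alpha> powr (\<sigma> ! i) * ?C) \<longlongrightarrow> 0) at_bot"
        using tendsto_mult_left_zero by fastforce
    qed
    then show ?thesis
      using 3 van all_nonzero by (simp del: nth_map) blast
  qed
  then show ?case by simp
qed

lemma max_actions_vexpr_map_iff: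
  fixes E :: "'n::finite \<Rightarrow> 'n mexpr"
  assumes "wf_vexpr E"
  shows "J \<in> max_actions (vexpr_map E) i \<longleftrightarrow> \<not> vanishes (- J) (E i)"
proof -
  let ?\<phi> = "\<lambda>\<alpha>. eval_mexpr (E i) (exp_vec (ray (- J) \<alpha>))"
  have wf: "wf_mexpr (E i)"
    using assms by (simp add: wf_vexpr_def)
  have mono: "?\<phi> a \<le> ?\<phi> b" if "a \<le> b" for a b
  proof -
    have "exp_vec (ray (- J) a) \<le> exp_vec (ray (- J) b)"
      unfolding exp_vec_mono using that by (simp add: less_eq_vec_def ray_def indicator_def)
    then show ?thesis
      by (intro eval_mexpr_mono wf exp_vec_pos)
  qed
  have "J \<in> max_actions (vexpr_map E) i \<longleftrightarrow> (\<exists>c>0. \<forall>\<alpha>. c \<le> ?\<phi> \<alpha>)"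
    using max_actions_lower_bound_iff[OF order_homogeneous_vexpr_map[OF assms]]
    by (simp add: vexpr_map_pos exp_vec_pos)
  also have "\<dots> \<longleftrightarrow> \<not> vanishes (- J) (E i)"
  proof
    assume "\<exists>c>0. \<forall>\<alpha>. c \<le> ?\<phi> \<alpha>"
    then obtain c where c: "0 < c" "\<And>\<alpha>. c \<le> ?\<phi> \<alpha>" by blast
    show "\<not> vanishes (- J) (E i)"
    proof
      assume "vanishes (- J) (E i)"
      then have "(?\<phi> \<longlongrightarrow> 0) at_bot"
        using vanishing_dichotomy[OF wf] by blast
      then have "c \<le> 0"
        by (rule tendsto_lowerbound) (use c(2) in auto)
      then show False using c(1) by simp
    qed
  next
    assume "\<not> vanishes (- J) (E i)"
    then obtain c where c: "0 < c" "\<forall>\<^sub>F \<alpha> in at_bot. c \<le> ?\<phi> \<alpha>"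
      using vanishing_dichotomy[OF wf] by blast
    then obtain a where a: "\<And>\<alpha>. \<alpha> \<le> a \<Longrightarrow> c \<le> ?\<phi> \<alpha>"
      by (auto simp: eventually_at_bot_linorder)
    have "c \<le> ?\<phi> \<alpha>" for \<alpha>
      using a[of "min a \<alpha>"] mono[of "min a \<alpha>" \<alpha>] by simp
    then show "\<exists>c>0. \<forall>\<alpha>. c \<le> ?\<phi> \<alpha>" using c(1) by blast
  qed
  finally show ?thesis .
qed

lemma wf_vexpr_reciprocal: "wf_vexpr E \<Longrightarrow> wf_vexpr (reciprocal_mexpr \<circ> E)"
  by (simp add: wf_vexpr_def wf_reciprocal_mexpr)

lemma wf_vexpr_sig: "wf_vexpr E \<Longrightarrow> wf_vexpr (sig_mexpr \<circ> E)"
  by (simp add: wf_vexpr_def wf_sig_mexpr)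

lemma log_conjugate_reciprocal:
  fixes E :: "'n::finite \<Rightarrow> 'n mexpr"
  assumes "wf_vexpr E"
  shows "log_conjugate (vexpr_map (reciprocal_mexpr \<circ> E)) = opposite (log_conjugate (vexpr_map E))"
proof
  fix x :: "real ^ 'n"
  have wf: "wf_mexpr (E i)" for i
    using assms by (simp add: wf_vexpr_def)
  have "eval_mexpr (reciprocal_mexpr (E i)) (exp_vec x) = inverse (eval_mexpr (E i) (exp_vec (- x)))" for i
    using eval_reciprocal_mexpr[OF wf, of i "- x"] by simp
  then show "log_conjugate (vexpr_map (reciprocal_mexpr \<circ> E)) x = opposite (log_conjugate (vexpr_map E)) x"
    by (simp add: log_conjugate_def opposite_def vec_eq_iff vexpr_map_pos exp_vec_pos ln_inverse
        eval_mexpr_pos wf)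
qed

text \<open>In logarithmic coordinates, the reciprocal expression is the opposite map, which exchanges the
  players.\<close>

lemma min_actions_vexpr_map:
  fixes E :: "'n::finite \<Rightarrow> 'n mexpr"
  assumes "wf_vexpr E"
  shows "min_actions (vexpr_map E) = max_actions (vexpr_map (reciprocal_mexpr \<circ> E))"
proof (intro ext set_eqI)
  fix i I
  have "opposite (opposite (log_conjugate (vexpr_map E))) = log_conjugate (vexpr_map E)"
    by (simp add: opposite_def fun_eq_iff)
  then show "I \<in> min_actions (vexpr_map E) i \<longleftrightarrow> I \<in> max_actions (vexpr_map (reciprocal_mexpr \<circ> E)) i"
    by (simp only: min_actions_iff[OF order_homogeneous_vexpr_map[OF assms]]
        max_actions_iff[OF order_homogeneous_vexpr_map[OF wf_vexpr_reciprocal[OF assms]]]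
        log_conjugate_reciprocal[OF assms])
qed

lemma max_actions_sig:
  fixes E :: "'n::finite \<Rightarrow> 'n mexpr"
  assumes "wf_vexpr E"
  shows "max_actions (vexpr_map (sig_mexpr \<circ> E)) = max_actions (vexpr_map E)"
proof (intro ext set_eqI)
  fix i J
  have "wf_mexpr (E i)"
    using assms by (simp add: wf_vexpr_def)
  then show "J \<in> max_actions (vexpr_map (sig_mexpr \<circ> E)) i \<longleftrightarrow> J \<in> max_actions (vexpr_map E) i"
    by (simp add: max_actions_vexpr_map_iff assms wf_vexpr_sig vanishes_sig_mexpr)
qed

lemma min_actions_sig:
  fixes E :: "'n::finite \<Rightarrow> 'n mexpr"
  assumes "wf_vexpr E"
  shows "min_actions (vexpr_map (sig_mexpr \<circ> E)) = min_actions (vexpr_map E)"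
proof -
  have "reciprocal_mexpr \<circ> (sig_mexpr \<circ> E) = sig_mexpr \<circ> (reciprocal_mexpr \<circ> E)"
    by (simp add: fun_eq_iff sig_reciprocal_mexpr)
  then show ?thesis
    using max_actions_sig[OF wf_vexpr_reciprocal[OF assms]]
    by (simp add: min_actions_vexpr_map assms wf_vexpr_sig)
qed

text \<open>Both games are equal to those of the signature maps, which coincide.\<close>

lemma dominion_condition_depends_on_signature:
  fixes E E' :: "'n::finite \<Rightarrow> 'n mexpr"
  assumes "wf_vexpr E" and "wf_vexpr E'" and "vsignature E' = vsignature E"
  shows "dominion_condition (vexpr_map E') \<longleftrightarrow> dominion_condition (vexpr_map E)"
proof -
  have same: "restrict (eval_mexpr (sig_mexpr (E' i))) nonneg_orthant
      = restrict (eval_mexpr (sig_mexpr (E i))) nonneg_orthant" for i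
    using fun_cong[OF assms(3), of i] by (simp add: vsignature_def signature_def mexpr_map_def)
  have "eval_mexpr (sig_mexpr (E' i)) x = eval_mexpr (sig_mexpr (E i)) x" if "x \<in> nonneg_orthant" for i x
    using fun_cong[OF same[of i], of x] that by simp
  then have "vexpr_map (sig_mexpr \<circ> E') = vexpr_map (sig_mexpr \<circ> E)"
    by (auto simp: vexpr_map_def vec_eq_iff intro!: restrict_ext)
  then have "min_actions (vexpr_map E') = min_actions (vexpr_map E)"
      "max_actions (vexpr_map E') = max_actions (vexpr_map E)"
    by (metis min_actions_sig max_actions_sig assms(1,2))+
  then show ?thesis
    by (simp add: dominion_condition_def)
qed


section \<open>The dominion condition and eigenvectors\<close>

lemma dominion_condition_imp_eigenvector:
  fixes f :: "real ^ 'n::finite \<Rightarrow> real ^ 'n"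
  assumes f: "order_homogeneous f" and "dominion_condition f"
  shows "has_pos_eigenvector f"
  using topical_has_eigenvector[OF topical_log_conjugate[OF f]] assms(2)
  unfolding has_pos_eigenvector_iff[OF f] dominion_condition_iff[OF f] by blast

text \<open>Multiplying the coordinates in \<open>J\<close> by \<open>exp b\<close> adds \<open>b\<close> to \<open>T\<close> on \<open>J\<close> and does not change it on
  \<open>I\<close>. An additive eigenvalue \<open>l\<close> of the new map satisfies \<open>l \<le> B\<close> because of \<open>I\<close> and
  \<open>b - l \<le> C\<close> because of \<open>J\<close>, which fails for \<open>b = B + C + 1\<close>.\<close>

lemma rescaling_without_eigenvector:
  fixes E :: "'n::finite \<Rightarrow> 'n mexpr"
  assumes wf: "wf_vexpr E" and "\<not> dominion_condition (vexpr_map E)"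
  shows "\<exists>c. (\<forall>i. 0 < c i) \<and> \<not> has_pos_eigenvector (vexpr_map (\<lambda>i. Scale (c i) (E i)))"
proof -
  let ?T = "log_conjugate (vexpr_map E)"
  note f = order_homogeneous_vexpr_map[OF wf]
  obtain I J where I: "closed_class ?T I" and J: "closed_class (opposite ?T) J" and "I \<inter> J = {}"
    using assms(2) unfolding dominion_condition_iff[OF f] by blast
  obtain B where B: "\<And>i \<alpha>. i \<in> I \<Longrightarrow> ?T (ray (- I) \<alpha>) $ i \<le> B"
    using closed_class_uniform_bound[OF I] by blast
  obtain C where C: "\<And>i \<alpha>. i \<in> J \<Longrightarrow> opposite ?T (ray (- J) \<alpha>) $ i \<le> C"
    using closed_class_uniform_bound[OF J] by blast
  define b where "b = B + C + 1"
  define c where "c = (\<lambda>i. if i \<in> J then exp b else 1)"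
  let ?E' = "\<lambda>i. Scale (c i) (E i)"
  have "0 < c i" for i
    by (simp add: c_def)
  have wf': "wf_vexpr ?E'"
    using wf \<open>\<And>i. 0 < c i\<close> by (simp add: wf_vexpr_def)
  have T': "log_conjugate (vexpr_map ?E') x $ i = ln (c i) + ?T x $ i" for x i
  proof -
    have "0 < eval_mexpr (E i) (exp_vec x)"
      using wf by (intro eval_mexpr_pos exp_vec_pos) (simp add: wf_vexpr_def)
    then show ?thesis
      using \<open>0 < c i\<close> by (simp add: log_conjugate_def vexpr_map_pos exp_vec_pos ln_mult)
  qed
  have "\<not> has_pos_eigenvector (vexpr_map ?E')"
  proof
    assume "has_pos_eigenvector (vexpr_map ?E')"
    then obtain u l where "log_conjugate (vexpr_map ?E') u = u + vec l"
      unfolding has_pos_eigenvector_iff[OF order_homogeneous_vexpr_map[OF wf']] by blast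
    then have eig: "ln (c i) + ?T u $ i = u $ i + l" for i
      using T'[of u i] by simp
    have "l \<le> B"
    proof (rule additive_eigenvalue_le[OF topical_log_conjugate[OF f] _ B])
      show "?T u $ i = u $ i + l" if "i \<in> I" for i
      proof -
        have "i \<notin> J"
          using that \<open>I \<inter> J = {}\<close> by blast
        then show ?thesis
          using eig[of i] by (simp add: c_def)
      qed
    qed (use I in \<open>auto simp: closed_class_def\<close>)
    moreover have "b - l \<le> C"
    proof (rule additive_eigenvalue_le[OF topical_opposite[OF topical_log_conjugate[OF f]] _ C])
      show "opposite ?T (- u) $ i = (- u) $ i + (b - l)" if "i \<in> J" for i
        using eig[of i] that by (simp add: c_def opposite_def)
    qed (use J in \<open>auto simp: closed_class_def\<close>)
    ultimately show False
      by (simp add: b_def)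
  qed
  then show ?thesis
    using \<open>\<And>i. 0 < c i\<close> by blast
qed

theorem theorem5p2:
  fixes E :: "'n::finite \<Rightarrow> 'n mexpr"
  assumes "wf_vexpr E"
  shows "(\<forall>E'. wf_vexpr E' \<and> vsignature E' = vsignature E \<longrightarrow>
            (dominion_condition (vexpr_map E') \<longleftrightarrow> dominion_condition (vexpr_map E)))
       \<and> (dominion_condition (vexpr_map E) \<longleftrightarrow>
            (\<forall>g\<in>Mbar. (\<exists>E'. wf_vexpr E' \<and> g = vexpr_map E' \<and> vsignature E' = vsignature E)
               \<longrightarrow> has_pos_eigenvector g))"
proof (intro conjI iffI)
  show sig: "\<forall>E'. wf_vexpr E' \<and> vsignature E' = vsignature E \<longrightarrow>
      (dominion_condition (vexpr_map E') \<longleftrightarrow> dominion_condition (vexpr_map E))"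
    using dominion_condition_depends_on_signature[OF assms] by blast
  assume "dominion_condition (vexpr_map E)"
  then show "\<forall>g\<in>Mbar. (\<exists>E'. wf_vexpr E' \<and> g = vexpr_map E' \<and> vsignature E' = vsignature E)
      \<longrightarrow> has_pos_eigenvector g"
    using sig dominion_condition_imp_eigenvector order_homogeneous_vexpr_map by blast
next
  assume all: "\<forall>g\<in>Mbar. (\<exists>E'. wf_vexpr E' \<and> g = vexpr_map E' \<and> vsignature E' = vsignature E)
      \<longrightarrow> has_pos_eigenvector g"
  have "has_pos_eigenvector (vexpr_map (\<lambda>i. Scale (c i) (E i)))" if "\<forall>i. 0 < c i" for c
  proof -
    let ?E' = "\<lambda>i. Scale (c i) (E i)"
    have "wf_vexpr ?E'"
      using assms that by (simp add: wf_vexpr_def)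
    moreover from this have "vexpr_map ?E' \<in> Mbar"
      by (auto simp: Mbar_def)
    moreover have "vsignature ?E' = vsignature E"
      by (simp add: vsignature_def signature_def)
    ultimately show ?thesis
      using all by blast
  qed
  then show "dominion_condition (vexpr_map E)"
    using rescaling_without_eigenvector[OF assms] by blast
qed

end
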